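(* Fix $k=2$ or $k=3$ and $\chi>0$. Let $\{p_n\}$, $\{s_n\}$ be the monic Legendre and monic Sobolev-Legendre orthogonal polynomials of the family $k$, with $p_{-1}:=0$, and let $d_n^{-2}=\|p_n\|_2^2$, $\xi_n^{-2}=\|s_n\|_S^2$. For $n\ge0$ let $f_{n+1}(x)=-\int_{SG}G(x,y)p_n(y)\,d\mu(y)$ and $$a_n=\frac{\langle f_{n+1},s_n\rangle_S}{\|s_n\|_S^2},\qquad b_n=\frac{\langle f_{n+1},p_n\rangle_2}{\|p_n\|_2^2},\qquad c_n=\frac{\langle f_{n+1},p_{n-1}\rangle_2}{\|p_{n-1}\|_2^2}\ \ (n\ge1).$$ Then for each $n\ge0$ $$s_n+\chi\Delta^2s_n=\Delta p_{n+1}+a_nd_n^2\xi_n^{-2}\,\Delta p_n+d_{n-1}^2\xi_n^{-2}\,\Delta p_{n-1}=p_n+\left(a_nd_n^2\xi_n^{-2}-b_n\right)\Delta p_n+\left(d_{n-1}^2\xi_n^{-2}-c_n\right)\Delta p_{n-1},$$ where for $n=0$ the terms containing $\Delta p_{-1}$ are $0$.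
   Context: Sierpinski gasket: let $q_0=(\tfrac12,\tfrac{\sqrt3}{2})$, $q_1=(0,0)$, $q_2=(1,0)$, $V_0=\{q_0,q_1,q_2\}$, $F_i(x)=\tfrac12(x-q_i)+q_i$, and let $SG\subset\mathbb R^2$ be the unique nonempty compact set with $SG=\bigcup_{i=0}^2F_i(SG)$. For a word $w=(w_1,\dots,w_m)\in\{0,1,2\}^m$, $|w|=m$, put $F_w=F_{w_1}\circ\cdots\circ F_{w_m}$; $F_w(SG)$ is called an $m$-cell; $V_m=\bigcup_{|w|=m}F_w(V_0)$; distinct $x,y\in V_m$ satisfy $x\sim_m y$ if they lie in a common $m$-cell. $\mu$ is the self-similar Borel probability measure with $\mu(F_w(SG))=3^{-|w|}$. All functions are real-valued. Energy and Laplacian: $\mathscr E(u,v)=\lim_{m\to\infty}(3/5)^{-m}\sum_{x\sim_m y}(u(x)-u(y))(v(x)-v(y))$ (sum over unordered pairs), and $u\in\operatorname{dom}\mathscr E$ if $\mathscr E(u,u)$ exists and is finite. For $u\in\operatorname{dom}\mathscr E$ and $f$ continuous, $\Delta u=f$ means $\mathscr E(u,v)=-\int_{SG}fv\,d\mu$ for all $v\in\operatorname{dom}\mathscr E$ vanishing on $V_0$. Indices of $q_i$ are mod 3. Normal derivative: $\partial_nu(q_i)=\lim_m(5/3)^m(2u(q_i)-u(F_i^mq_{i+1})-u(F_i^mq_{i-1}))$. Tangential derivative: $\partial_Tu(q_i)=\lim_m5^m(u(F_i^mq_{i+1})-u(F_i^mq_{i-1}))$. Green's function: $G(x,y)$ is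 the (continuous, symmetric) Green's function of the Dirichlet problem: for $f$ continuous, $-\Delta u=f$ and $u|_{V_0}=0$ iff $u(x)=\int_{SG}G(x,y)f(y)\,d\mu(y)$. Monomials: for $j\ge0$, $k\in\{1,2,3\}$, $P_{j,k}$ is the unique function with $\Delta^{j+1}P_{j,k}=0$ such that for all $0\le n\le j$: $\Delta^nP_{j,k}(q_0)=\delta_{nj}\delta_{k1}$, $\partial_n\Delta^nP_{j,k}(q_0)=\delta_{nj}\delta_{k2}$, $\partial_T\Delta^nP_{j,k}(q_0)=\delta_{nj}\delta_{k3}$. In particular $\Delta P_{j,k}=P_{j-1,k}$ with $P_{-1,k}=0$. Inner products: $\langle f,g\rangle_2=\int_{SG}fg\,d\mu$ with norm $\|\cdot\|_2$; $\langle f,g\rangle_S=\int_{SG}fg\,d\mu+\chi\int_{SG}\Delta f\,\Delta g\,d\mu$ with norm $\|\cdot\|_S$. For fixed $k$, $\{p_{n}\}$ (monic Legendre) and $\{s_{n}\}$ (monic Sobolev-Legendre) are obtained from $P_{0,k},P_{1,k},\dots$ by Gram-Schmidt without normalization with respect to $\langle\cdot,\cdot\rangle_2$ and $\langle\cdot,\cdot\rangle_S$ respectively; i.e. each of $p_{n}$, $s_{n}$ equals $P_{n,k}$ plus a linear combination of $P_{0,k},\dots,P_{n-1,k}$ and is orthogonal to $P_{0,k},\dots,P_{n-1,k}$. *)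

theory Defs
  imports "HOL-Probability.Probability"
begin

section \<open>The Sierpinski gasket and its self-similar measure\<close>

text \<open>Indices are read mod 3, so that \<open>q\<^sub>i\<^sub>-\<^sub>1\<close> is \<open>sg_q (i + 2)\<close>.\<close>

definition sg_q :: "nat \<Rightarrow> real^2" where
  "sg_q i = (if i mod 3 = 0 then vector [1/2, sqrt 3 / 2]
             else if i mod 3 = 1 then vector [0, 0]
             else vector [1, 0])"

definition sg_F :: "nat \<Rightarrow> real^2 \<Rightarrow> real^2" where
  "sg_F i x = (1/2) *\<^sub>R (x - sg_q i) + sg_q i"

definition SG :: "(real^2) set" where
  "SG = (THE K. compact K \<and> K \<noteq> {} \<and> K = (\<Union>i\<in>{0,1,2}. sg_F i ` K))"

definition sg_words :: "nat \<Rightarrow> nat list set" where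
  "sg_words m = {w. length w = m \<and> set w \<subseteq> {0,1,2}}"

text \<open>The first letter of a word is the outermost map.\<close>

definition sg_Fw :: "nat list \<Rightarrow> real^2 \<Rightarrow> real^2" where
  "sg_Fw w = foldr (\<lambda>i g. sg_F i \<circ> g) w id"

definition sg_cell :: "nat list \<Rightarrow> (real^2) set" where
  "sg_cell w = sg_Fw w ` SG"

definition sg_V0 :: "(real^2) set" where
  "sg_V0 = {sg_q 0, sg_q 1, sg_q 2}"

definition sg_V :: "nat \<Rightarrow> (real^2) set" where
  "sg_V m = (\<Union>w\<in>sg_words m. sg_Fw w ` sg_V0)"

definition sg_adj :: "nat \<Rightarrow> real^2 \<Rightarrow> real^2 \<Rightarrow> bool" where
  "sg_adj m x y \<longleftrightarrow> x \<in> sg_V m \<and> y \<in> sg_V m \<and> x \<noteq> y \<and>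
     (\<exists>w\<in>sg_words m. x \<in> sg_cell w \<and> y \<in> sg_cell w)"

text \<open>The measure lives on the Borel sets of the plane; the mass condition for the empty word
  says that it is concentrated on the gasket.\<close>

definition is_sg_measure :: "(real^2) measure \<Rightarrow> bool" where
  "is_sg_measure \<mu> \<longleftrightarrow> prob_space \<mu> \<and> sets \<mu> = sets borel \<and>
     (\<forall>A\<in>sets borel. measure \<mu> A = (\<Sum>i\<in>{0,1,2}. (1/3) * measure \<mu> (sg_F i -` A))) \<and>
     (\<forall>w. set w \<subseteq> {0,1,2} \<longrightarrow> measure \<mu> (sg_cell w) = (1/3) ^ length w)"

section \<open>Energy and Laplacian\<close>

text \<open>Functions on the gasket are functions on the plane whose values off \<^term>\<open>SG\<close> are irrelevant.\<close>

text \<open>The sum is over ordered pairs; the factor 1/2 makes it a sum over unordered pairs.\<close>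

definition energy_level :: "nat \<Rightarrow> (real^2 \<Rightarrow> real) \<Rightarrow> (real^2 \<Rightarrow> real) \<Rightarrow> real" where
  "energy_level m u v = (3/5) powi (- int m) *
     ((1/2) * (\<Sum>(x, y)\<in>{(x, y). sg_adj m x y}. (u x - u y) * (v x - v y)))"

definition energy :: "(real^2 \<Rightarrow> real) \<Rightarrow> (real^2 \<Rightarrow> real) \<Rightarrow> real" where
  "energy u v = lim (\<lambda>m. energy_level m u v)"

text \<open>Finite energy controls \<open>u\<close> only on the vertices, which are dense in the gasket.
  As usual, the domain consists of continuous functions.\<close>

definition dom_energy :: "(real^2 \<Rightarrow> real) set" where
  "dom_energy = {u. continuous_on SG u \<and> convergent (\<lambda>m. energy_level m u u)}"

definition has_laplacian ::
  "(real^2) measure \<Rightarrow> (real^2 \<Rightarrow> real) \<Rightarrow> (real^2 \<Rightarrow> real) \<Rightarrow> bool" where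
  "has_laplacian \<mu> u f \<longleftrightarrow> u \<in> dom_energy \<and> continuous_on SG f \<and>
     (\<forall>v\<in>dom_energy. (\<forall>x\<in>sg_V0. v x = 0) \<longrightarrow>
        energy u v = - (LINT x:SG|\<mu>. f x * v x))"

definition dom_laplacian :: "(real^2) measure \<Rightarrow> (real^2 \<Rightarrow> real) set" where
  "dom_laplacian \<mu> = {u. \<exists>f. has_laplacian \<mu> u f}"

text \<open>The Laplacian is determined on the gasket only; extending it by 0 makes it unique.\<close>

definition laplacian :: "(real^2) measure \<Rightarrow> (real^2 \<Rightarrow> real) \<Rightarrow> real^2 \<Rightarrow> real" where
  "laplacian \<mu> u = (THE f. has_laplacian \<mu> u f \<and> (\<forall>x. x \<notin> SG \<longrightarrow> f x = 0))"

definition has_normal_deriv :: "(real^2 \<Rightarrow> real) \<Rightarrow> nat \<Rightarrow> real \<Rightarrow> bool" where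
  "has_normal_deriv u i d \<longleftrightarrow>
     (\<lambda>m. (5/3) ^ m * (2 * u (sg_q i) - u ((sg_F i ^^ m) (sg_q (i + 1)))
                                      - u ((sg_F i ^^ m) (sg_q (i + 2))))) \<longlonglongrightarrow> d"

definition has_tangential_deriv :: "(real^2 \<Rightarrow> real) \<Rightarrow> nat \<Rightarrow> real \<Rightarrow> bool" where
  "has_tangential_deriv u i d \<longleftrightarrow>
     (\<lambda>m. 5 ^ m * (u ((sg_F i ^^ m) (sg_q (i + 1)))
                   - u ((sg_F i ^^ m) (sg_q (i + 2))))) \<longlonglongrightarrow> d"

definition is_green :: "(real^2) measure \<Rightarrow> (real^2 \<Rightarrow> real^2 \<Rightarrow> real) \<Rightarrow> bool" where
  "is_green \<mu> G \<longleftrightarrow>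
     continuous_on (SG \<times> SG) (\<lambda>(x, y). G x y) \<and>
     (\<forall>x\<in>SG. \<forall>y\<in>SG. G x y = G y x) \<and>
     (\<forall>f u. continuous_on SG f \<longrightarrow>
        (has_laplacian \<mu> u (\<lambda>x. - f x) \<and> (\<forall>x\<in>sg_V0. u x = 0)
         \<longleftrightarrow> (\<forall>x\<in>SG. u x = (LINT y:SG|\<mu>. G x y * f y))))"

section \<open>Monomials and orthogonal polynomials\<close>

definition is_monomial ::
  "(real^2) measure \<Rightarrow> nat \<Rightarrow> nat \<Rightarrow> (real^2 \<Rightarrow> real) \<Rightarrow> bool" where
  "is_monomial \<mu> j k u \<longleftrightarrow>
     (\<forall>n\<le>j. (laplacian \<mu> ^^ n) u \<in> dom_laplacian \<mu>) \<and>
     (\<forall>x\<in>SG. (laplacian \<mu> ^^ (j + 1)) u x = 0) \<and>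
     (\<forall>n\<le>j.
        (laplacian \<mu> ^^ n) u (sg_q 0) = of_bool (n = j) * of_bool (k = 1) \<and>
        has_normal_deriv ((laplacian \<mu> ^^ n) u) 0 (of_bool (n = j) * of_bool (k = 2)) \<and>
        has_tangential_deriv ((laplacian \<mu> ^^ n) u) 0 (of_bool (n = j) * of_bool (k = 3)))"

definition l2_inner ::
  "(real^2) measure \<Rightarrow> (real^2 \<Rightarrow> real) \<Rightarrow> (real^2 \<Rightarrow> real) \<Rightarrow> real" where
  "l2_inner \<mu> f g = (LINT x:SG|\<mu>. f x * g x)"

definition l2_norm :: "(real^2) measure \<Rightarrow> (real^2 \<Rightarrow> real) \<Rightarrow> real" where
  "l2_norm \<mu> f = sqrt (l2_inner \<mu> f f)"

definition sob_inner ::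
  "(real^2) measure \<Rightarrow> real \<Rightarrow> (real^2 \<Rightarrow> real) \<Rightarrow> (real^2 \<Rightarrow> real) \<Rightarrow> real" where
  "sob_inner \<mu> chi f g = (LINT x:SG|\<mu>. f x * g x)
                       + chi * (LINT x:SG|\<mu>. laplacian \<mu> f x * laplacian \<mu> g x)"

definition sob_norm :: "(real^2) measure \<Rightarrow> real \<Rightarrow> (real^2 \<Rightarrow> real) \<Rightarrow> real" where
  "sob_norm \<mu> chi f = sqrt (sob_inner \<mu> chi f f)"

text \<open>\<open>p\<close> is the result of Gram-Schmidt without normalization applied to \<open>Q 0, Q 1, \<dots>\<close>.\<close>

definition is_monic_orthogonal ::
  "((real^2 \<Rightarrow> real) \<Rightarrow> (real^2 \<Rightarrow> real) \<Rightarrow> real) \<Rightarrow>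
   (nat \<Rightarrow> real^2 \<Rightarrow> real) \<Rightarrow> (nat \<Rightarrow> real^2 \<Rightarrow> real) \<Rightarrow> bool" where
  "is_monic_orthogonal ip Q p \<longleftrightarrow>
     (\<forall>n. (\<exists>c. \<forall>x\<in>SG. p n x = Q n x + (\<Sum>j<n. c j * Q j x)) \<and>
          (\<forall>j<n. ip (p n) (Q j) = 0))"

end

theory Submission imports Defs begin

text \<open>
  Let \<open>T g = -\<integral> G(\<cdot>, y) g(y) d\<mu>(y)\<close>; it is symmetric in \<open>L\<^sup>2\<close> and \<open>\<Delta>(T g) = g\<close>.  By parity under the
  reflection fixing \<open>q\<^sub>0\<close>, \<open>T\<close> maps monic polynomials of degree \<open>n\<close> of the family to monic ones of
  degree \<open>n + 1\<close>.  Hence \<open>U = T s\<^sub>n + \<chi> \<Delta>s\<^sub>n\<close> is monic of degree \<open>n + 1\<close>, and since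
  \<open>\<langle>p\<^sub>m, U\<rangle>\<^sub>2 = \<langle>T p\<^sub>m, s\<^sub>n\<rangle>\<^sub>S\<close> vanishes for \<open>m + 1 < n\<close>, it is a combination of
  \<open>p\<^sub>n\<^sub>+\<^sub>1, p\<^sub>n, p\<^sub>n\<^sub>-\<^sub>1\<close>.  The same holds for \<open>T p\<^sub>n\<close>.  Applying \<open>\<Delta>\<close> to both expansions gives
  the two formulas.

  The definite description behind the Laplacian requires uniqueness, i.e. enough functions of
  finite energy.  They are obtained from one nonconstant function by a Lipschitz truncation that
  vanishes on \<open>V\<^sub>0\<close>, copied into small cells.  Uniqueness of monomials needs no explicit harmonic
  extension: the Dirichlet problem bounds the dimension of the harmonic functions by 3.
\<close>

section \<open>Geometry of the gasket\<close>

text \<open>The restriction to \<open>k = 2\<close> or \<open>k = 3\<close> is what keeps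
  \<open>T\<close> inside the family. The harmonic correction of an antiderivative vanishes at
  \<open>sg_q 0\<close>; for \<open>k = 1\<close> it would moreover be even, hence a multiple of
  \<open>P 0 2\<close>, which lies in another family. No formula for \<open>G\<close> is used. The
  equivalence in \<open>is_green\<close> solves the Dirichlet problem when read in one direction
  and, with right-hand side zero, gives uniqueness when read in the other. The masses of the cells
  yield positivity of integrals, null overlaps of cells and, through averages over vertices,
  invariance of the integral under the reflection. Since functions are arbitrary off
  \<open>SG\<close>, equalities are asserted on \<open>SG\<close> only, and congruence lemmas carry
  them through energy, Laplacian and inner products.\<close>

lemma sg_F_alt: "sg_F i x = (1/2) *\<^sub>R (x + sg_q i)"
  by (simp add: sg_F_def vec_eq_iff field_simps)

definition sg_Finv :: "nat \<Rightarrow> real^2 \<Rightarrow> real^2" where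
  "sg_Finv i x = 2 *\<^sub>R x - sg_q i"

lemma sg_Finv_F [simp]: "sg_Finv i (sg_F i x) = x"
  by (simp add: sg_Finv_def sg_F_alt)

lemma sg_F_inject [simp]: "sg_F i x = sg_F i y \<longleftrightarrow> x = y"
  by (metis sg_Finv_F)

lemma sg_F_q [simp]: "sg_F i (sg_q i) = sg_q i"
  by (simp add: sg_F_def)

lemma norm_sg_F_diff: "norm (sg_F i x - sg_F i y) = norm (x - y) / 2"
  by (simp add: sg_F_def flip: scaleR_diff_right)

lemma continuous_on_sg_F [continuous_intros]:
  "continuous_on S g \<Longrightarrow> continuous_on S (\<lambda>x. sg_F i (g x))"
  unfolding sg_F_def by (intro continuous_intros)

lemma sg_q_simps:
  "sg_q 0 $ 1 = 1/2" "sg_q 0 $ 2 = sqrt 3 / 2"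
  "sg_q (Suc 0) $ 1 = 0" "sg_q (Suc 0) $ 2 = 0"
  "sg_q 2 $ 1 = 1" "sg_q 2 $ 2 = 0"
  by (simp_all add: sg_q_def)

lemma norm_sg_q_le: "norm (sg_q i) \<le> 1"
proof -
  have "norm (sg_q i) ^ 2 \<le> 1"
    by (simp add: sg_q_def norm_vec_def L2_set_def sum_2 power2_eq_square)
  then show ?thesis by (simp add: power_le_one_iff abs_square_le_1)
qed

text \<open>The barycentric coordinates with respect to the triangle with vertices
  \<open>sg_q 0\<close>, \<open>sg_q 1\<close>, \<open>sg_q 2\<close>. They turn the overlap of
  cells into inequalities between numbers.\<close>

definition bary :: "nat \<Rightarrow> real^2 \<Rightarrow> real" where
  "bary i x = (if i = 0 then 2 / sqrt 3 * x $ 2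
     else if i = 1 then 1 - x $ 1 - x $ 2 / sqrt 3 else x $ 1 - x $ 2 / sqrt 3)"

lemma bary_sum: "bary 0 x + bary 1 x + bary 2 x = 1"
  by (simp add: bary_def field_simps)

lemma bary_F:
  assumes "i \<in> {0,1,2}" "j \<in> {0,1,2}"
  shows "bary i (sg_F j x) = bary i x / 2 + of_bool (i = j) / 2"
  using assms by (auto simp: bary_def sg_F_alt sg_q_simps field_simps)

lemma bary_q:
  assumes "i \<in> {0,1,2}" "j \<in> {0,1,2}"
  shows "bary i (sg_q j) = of_bool (i = j)"
  using assms by (auto simp: bary_def sg_q_simps field_simps)

lemma bary_inject:
  assumes "\<And>i. i \<in> {0,1,2} \<Longrightarrow> bary i x = bary i y"
  shows "x = y"
proof -
  have "x $ 2 = y $ 2" using assms[of 0] by (simp add: bary_def)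
  moreover from this have "x $ 1 = y $ 1" using assms[of 2] by (simp add: bary_def)
  ultimately show ?thesis by (simp add: vec_eq_iff forall_2)
qed

lemma sg_F_q_swap:
  assumes "i \<in> {0,1,2}" "j \<in> {0,1,2}"
  shows "sg_F i (sg_q j) = sg_F j (sg_q i)"
  by (simp add: sg_F_alt add.commute)

lemma continuous_on_bary: "continuous_on S (bary i)"
  unfolding bary_def by (cases "i = 0"; cases "i = 1") (auto intro!: continuous_intros)

section \<open>Existence and uniqueness of the fixed point of the Hutchinson operator\<close>

definition gasket_step :: "(real^2) set \<Rightarrow> (real^2) set" where
  "gasket_step K = (\<Union>i\<in>{0,1,2}. sg_F i ` K)"

text \<open>A point of \<open>K\<close> farthest from \<open>L\<close> is the image of some
  \<open>y\<close> in \<open>K\<close> under one of the contractions. That contraction sends a point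
  of \<open>L\<close> nearest to \<open>y\<close> into \<open>L\<close> and halves the distance, so
  the maximal distance is at most half of itself. One inclusion is enough, because the hypotheses
  are symmetric.\<close>

lemma gasket_unique:
  assumes K: "compact K" "K \<noteq> {}" "K = gasket_step K"
    and L: "compact L" "L \<noteq> {}" "L = gasket_step L"
  shows "K \<subseteq> L"
proof -
  have "continuous_on K (\<lambda>x. infdist x L)" by (intro continuous_intros)
  then obtain x where x: "x \<in> K" "\<And>y. y \<in> K \<Longrightarrow> infdist y L \<le> infdist x L"
    using continuous_attains_sup[OF K(1,2)] by metis
  from x(1) obtain i y where y: "i \<in> {0,1,2}" "y \<in> K" "x = sg_F i y"
    using K(3) unfolding gasket_step_def by blast
  obtain z where z: "z \<in> L" "infdist y L = dist y z"
    using infdist_attains_inf[of L y] L compact_imp_closed by metis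
  have "sg_F i z \<in> L" using L(3) y(1) z(1) by (auto simp: gasket_step_def)
  then have "infdist x L \<le> dist x (sg_F i z)" by (rule infdist_le)
  also have "\<dots> = dist y z / 2" by (simp add: y(3) dist_norm norm_sg_F_diff)
  also have "\<dots> \<le> infdist x L / 2" using z x(2)[OF y(2)] by simp
  finally have "infdist x L \<le> 0" by simp
  then have "infdist y L = 0" if "y \<in> K" for y
    using x(2)[OF that] infdist_nonneg[of y L] by linarith
  then show ?thesis
    using in_closed_iff_infdist_zero[OF compact_imp_closed[OF L(1)] L(2)] by blast
qed

text \<open>The unit ball contains the three fixed points, so it contains its image and the iterates
  form a decreasing sequence of nonempty compact sets. Their intersection is the fixed
  point.\<close>

lemma gasket_exists: "\<exists>K. compact K \<and> K \<noteq> {} \<and> K = gasket_step K"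
proof -
  define A where "A n = (gasket_step ^^ n) (cball 0 1)" for n
  have AS: "A (Suc n) = gasket_step (A n)" for n by (simp add: A_def)
  have mono: "gasket_step X \<subseteq> gasket_step Y" if "X \<subseteq> Y" for X Y
    using that by (auto simp: gasket_step_def)
  have comp: "compact (A n) \<and> A n \<noteq> {}" for n
    by (induction n) (auto simp: A_def gasket_step_def intro!: compact_Un compact_continuous_image continuous_intros)
  have dec1: "A (Suc n) \<subseteq> A n" for n
  proof (induction n)
    case 0
    have "norm (sg_F i x) \<le> 1" if "norm x \<le> 1" for i x
      using norm_triangle_le[of x "sg_q i" 2] norm_sg_q_le[of i] that by (simp add: sg_F_alt)
    then show ?case by (auto simp: A_def gasket_step_def)
  next
    case (Suc n) then show ?case using mono AS by auto
  qed
  have dec: "A n \<subseteq> A m" if "m \<le> n" for m n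
    using lift_Suc_antimono_le[of A m n] dec1 that by blast
  define K where "K = (\<Inter>n. A n)"
  have cK: "compact K" unfolding K_def by (rule compact_Inter) (use comp in auto)
  have neK: "K \<noteq> {}"
    unfolding K_def by (rule compact_nest) (use comp dec in auto)
  have "gasket_step K \<subseteq> A (Suc n)" for n
    unfolding AS by (rule mono) (auto simp: K_def)
  then have "gasket_step K \<subseteq> K" unfolding K_def using dec1 by blast
  moreover have "K \<subseteq> gasket_step K"
  proof
    fix x assume x: "x \<in> K"
    have "\<exists>i\<in>{0,1,2}. sg_Finv i x \<in> A n" for n
    proof -
      have "x \<in> A (Suc n)" using x by (auto simp: K_def)
      then show ?thesis by (auto simp: AS gasket_step_def)
    qed
    then obtain g where g: "\<And>n. g n \<in> {0,1,2::nat}" "\<And>n. sg_Finv (g n) x \<in> A n" by metis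
    \<comment> \<open>The index of a suitable map may depend on \<open>n\<close>, but one index
      recurs infinitely often; since the sets decrease, it serves every \<open>n\<close>.\<close>
    have "finite (range g)" using g(1) by (meson finite.emptyI finite.insertI finite_subset image_subsetI)
    then obtain n0 where inf: "infinite {n. g n = g n0}"
      using pigeonhole_infinite[of UNIV g] by auto
    have "sg_Finv (g n0) x \<in> A n" for n
    proof -
      obtain k where "k \<ge> n" "g k = g n0"
        using inf by (metis (mono_tags, lifting) infinite_nat_iff_unbounded_le mem_Collect_eq)
      then show ?thesis using g(2)[of k] dec by auto
    qed
    then have "sg_Finv (g n0) x \<in> K" by (auto simp: K_def)
    moreover have "x = sg_F (g n0) (sg_Finv (g n0) x)" by (simp add: sg_F_alt sg_Finv_def)
    ultimately show "x \<in> gasket_step K" unfolding gasket_step_def using g(1) by blast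
  qed
  ultimately show ?thesis using cK neK by blast
qed

lemma SG_props: "compact SG \<and> SG \<noteq> {} \<and> SG = (\<Union>i\<in>{0,1,2}. sg_F i ` SG)"
  unfolding SG_def
  unfolding gasket_step_def[symmetric]
proof (rule theI')
  obtain K where "compact K \<and> K \<noteq> {} \<and> K = gasket_step K" using gasket_exists by blast
  then show "\<exists>!K. compact K \<and> K \<noteq> {} \<and> K = gasket_step K"
    using gasket_unique by (intro ex1I[of _ K] conjI subset_antisym) auto
qed

lemma compact_SG: "compact SG" and SG_nonempty: "SG \<noteq> {}"
  and SG_eq: "SG = (\<Union>i\<in>{0,1,2}. sg_F i ` SG)"
  using SG_props by auto

lemma sg_F_in_SG: "i \<in> {0,1,2} \<Longrightarrow> x \<in> SG \<Longrightarrow> sg_F i x \<in> SG"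
  using SG_eq by blast

lemma SG_cases:
  assumes "x \<in> SG"
  obtains i y where "i \<in> {0,1,2}" "y \<in> SG" "x = sg_F i y"
  using assms SG_eq by blast

section \<open>Boundary vertices and the overlap of 1-cells\<close>

lemma sg_F_pow: "(sg_F i ^^ m) x = sg_q i + (1/2)^m *\<^sub>R (x - sg_q i)"
  by (induction m) (simp_all add: sg_F_def)

lemma sg_F_pow_tendsto: "(\<lambda>m. (sg_F i ^^ m) x) \<longlonglongrightarrow> sg_q i"
proof -
  have "(\<lambda>m. sg_q i + (1/2::real)^m *\<^sub>R (x - sg_q i)) \<longlonglongrightarrow> sg_q i + 0 *\<^sub>R (x - sg_q i)"
    by (intro tendsto_intros LIMSEQ_realpow_zero) auto
  then show ?thesis by (simp add: sg_F_pow)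
qed

lemma sg_F_pow_in_SG: "i \<in> {0,1,2} \<Longrightarrow> x \<in> SG \<Longrightarrow> (sg_F i ^^ m) x \<in> SG"
  by (induction m) (simp_all add: sg_F_in_SG)

lemma sg_q_in_SG:
  assumes "i \<in> {0,1,2}" shows "sg_q i \<in> SG"
proof -
  obtain x where "x \<in> SG" using SG_nonempty by auto
  then show ?thesis
    using closed_sequentially[OF compact_imp_closed[OF compact_SG] _ sg_F_pow_tendsto]
      sg_F_pow_in_SG[OF assms] by blast
qed

lemma sg_V0_subset: "sg_V0 \<subseteq> SG"
  using sg_q_in_SG by (auto simp: sg_V0_def)

text \<open>At a minimum point \<open>z = sg_F j y\<close> the coordinate is at least half its value
  at \<open>y\<close>, hence at least half of the minimum. A number that is at least half of itself
  is nonnegative.\<close>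

lemma bary_nonneg:
  assumes "i \<in> {0,1,2}" "x \<in> SG" shows "0 \<le> bary i x"
proof -
  obtain z where z: "z \<in> SG" "\<And>y. y \<in> SG \<Longrightarrow> bary i z \<le> bary i y"
    using continuous_attains_inf[OF compact_SG SG_nonempty continuous_on_bary[of _ i]] by metis
  obtain j y where y: "j \<in> {0,1,2}" "y \<in> SG" "z = sg_F j y" using SG_cases[OF z(1)] .
  have "bary i y / 2 \<le> bary i z" using bary_F[OF assms(1) y(1)] y(3) by simp
  then have "0 \<le> bary i z" using z(2)[OF y(2)] by linarith
  then show ?thesis using z(2)[OF assms(2)] by linarith
qed

text \<open>Distinct 1-cells meet only at junction points. Comparing the \<open>j\<close>-th
  coordinates of the common image gives \<open>bary j x = bary j y + 1\<close>, so that coordinate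
  of \<open>x\<close> is at least 1; nonnegativity and total sum 1 leave only the vertex.\<close>

lemma sg_F_eq_F:
  assumes "i \<in> {0,1,2}" "j \<in> {0,1,2}" "i \<noteq> j" "x \<in> SG" "y \<in> SG" "sg_F i x = sg_F j y"
  shows "x = sg_q j"
proof -
  have "bary j x = bary j y + 1"
    using bary_F[OF assms(2,1), of x] bary_F[OF assms(2,2), of y] assms(3,6) by simp
  moreover have "0 \<le> bary l x" "0 \<le> bary j y" if "l \<in> {0,1,2}" for l
    using bary_nonneg assms(2,4,5) that by auto
  ultimately have *: "1 \<le> bary j x" "0 \<le> bary 0 x" "0 \<le> bary 1 x" "0 \<le> bary 2 x"
    by fastforce+
  have "bary l x = bary l (sg_q j)" if l: "l \<in> {0,1,2}" for l
  proof -
    have "bary l x = of_bool (l = j)"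
      using assms(2) l * bary_sum[of x] by (elim insertE emptyE) simp_all
    then show ?thesis using bary_q[OF l assms(2)] by simp
  qed
  then show ?thesis by (rule bary_inject)
qed

subsection \<open>Words and cells\<close>

lemma sg_words_0: "sg_words 0 = {[]}"
  by (auto simp: sg_words_def)

lemma sg_words_Suc: "sg_words (Suc m) = (\<lambda>(i, w). i # w) ` ({0,1,2} \<times> sg_words m)"
  by (auto simp: sg_words_def length_Suc_conv image_iff)

lemma UN_sg_words_Suc:
  "(\<Union>w\<in>sg_words (Suc m). X w) = (\<Union>i\<in>{0,1,2}. \<Union>w\<in>sg_words m. X (i # w))"
proof -
  have "(\<Union>w\<in>(\<lambda>(i, w). i # w) ` (A \<times> B). X w) = (\<Union>i\<in>A. \<Union>w\<in>B. X (i # w))" for A B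
    by auto
  then show ?thesis unfolding sg_words_Suc .
qed

lemma finite_sg_words: "finite (sg_words m)"
  by (induction m) (simp_all add: sg_words_0 sg_words_Suc)

lemma card_sg_words: "card (sg_words m) = 3 ^ m"
  by (induction m)
    (simp_all add: sg_words_0 sg_words_Suc card_image inj_on_def card_cartesian_product)

lemma sg_Fw_simps [simp]: "sg_Fw [] = id" "sg_Fw (i # w) = sg_F i \<circ> sg_Fw w"
  by (simp_all add: sg_Fw_def)

lemma sg_cell_simps: "sg_cell [] = SG" "sg_cell (i # w) = sg_F i ` sg_cell w"
  by (auto simp: sg_cell_def)

lemma sg_Fw_in_SG: "set w \<subseteq> {0,1,2} \<Longrightarrow> x \<in> SG \<Longrightarrow> sg_Fw w x \<in> SG"
  by (induction w) (auto simp del: insert_iff intro!: sg_F_in_SG)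

lemma sg_cell_subset: "set w \<subseteq> {0,1,2} \<Longrightarrow> sg_cell w \<subseteq> SG"
  using sg_Fw_in_SG by (auto simp: sg_cell_def)

lemma continuous_on_sg_Fw: "continuous_on S (sg_Fw w)"
  by (induction w) (auto simp: o_def intro!: continuous_intros)

lemma compact_sg_cell: "compact (sg_cell w)"
  unfolding sg_cell_def by (intro compact_continuous_image continuous_on_sg_Fw compact_SG)

lemma norm_sg_Fw_diff: "norm (sg_Fw w x - sg_Fw w y) = norm (x - y) / 2 ^ length w"
  by (induction w) (simp_all add: norm_sg_F_diff)

lemma SG_eq_cells: "SG = (\<Union>w\<in>sg_words m. sg_cell w)"
proof (induction m)
  case 0 then show ?case by (simp add: sg_words_0 sg_cell_simps)
next
  case (Suc m)
  have "SG = (\<Union>i\<in>{0,1,2}. sg_F i ` (\<Union>w\<in>sg_words m. sg_cell w))"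
    unfolding Suc[symmetric] by (rule SG_eq)
  then show ?case by (simp only: UN_sg_words_Suc sg_cell_simps image_UN)
qed

text \<open>At the first letter where the words differ, the two cells lie in different 1-cells of a
  smaller copy, which meet in one point.\<close>

lemma sg_cells_inter:
  assumes "length w = length w'" "set w \<subseteq> {0,1,2}" "set w' \<subseteq> {0,1,2}" "w \<noteq> w'"
  shows "\<exists>z. sg_cell w \<inter> sg_cell w' \<subseteq> {z}"
  using assms
proof (induction w w' rule: list_induct2)
  case Nil then show ?case by simp
next
  case (Cons i w j w')
  show ?case
  proof (cases "i = j")
    case True
    then obtain z where "sg_cell w \<inter> sg_cell w' \<subseteq> {z}" using Cons by auto
    then show ?thesis using True by (auto simp: sg_cell_simps intro!: exI[of _ "sg_F i z"])
  next
    case False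
    have "sg_cell w \<subseteq> SG" "sg_cell w' \<subseteq> SG" using Cons.prems sg_cell_subset by auto
    then have "sg_cell (i # w) \<inter> sg_cell (j # w') \<subseteq> {sg_F i (sg_q j)}"
      using sg_F_eq_F[of i j] Cons.prems False unfolding sg_cell_simps set_simps by blast
    then show ?thesis ..
  qed
qed

subsection \<open>Vertices and edges\<close>

lemma sg_V_0: "sg_V 0 = sg_V0"
  by (simp add: sg_V_def sg_words_0)

lemma sg_V_Suc: "sg_V (Suc m) = (\<Union>i\<in>{0,1,2}. sg_F i ` sg_V m)"
  unfolding sg_V_def UN_sg_words_Suc image_UN by (simp only: sg_Fw_simps image_comp)

lemma sg_V_Suc_iff: "x \<in> sg_V (Suc m) \<longleftrightarrow> (\<exists>i\<in>{0,1,2}. \<exists>z\<in>sg_V m. x = sg_F i z)"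
  by (simp only: sg_V_Suc UN_iff image_iff)

lemma finite_sg_V: "finite (sg_V m)"
  by (induction m) (simp_all add: sg_V_0 sg_V_Suc sg_V0_def)

lemma sg_V_subset: "sg_V m \<subseteq> SG"
proof (induction m)
  case 0 then show ?case by (simp add: sg_V_0 sg_V0_subset)
next
  case (Suc m) then show ?case unfolding sg_V_Suc using sg_F_in_SG by blast
qed

lemma sg_q_in_V: "i \<in> {0,1,2} \<Longrightarrow> sg_q i \<in> sg_V m"
proof (induction m)
  case 0 then show ?case by (auto simp: sg_V_0 sg_V0_def)
next
  case (Suc m) then show ?case unfolding sg_V_Suc by (metis UN_iff image_eqI sg_F_q)
qed

text \<open>Ordered pairs: each edge occurs in both orientations, which the factor 1/2 in
  \<open>energy_level\<close> compensates.\<close>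

definition sg_edges :: "nat \<Rightarrow> ((real^2) \<times> (real^2)) set" where
  "sg_edges m = {(x, y). sg_adj m x y}"

lemma finite_sg_edges: "finite (sg_edges m)"
  by (rule finite_subset[of _ "sg_V m \<times> sg_V m"])
    (auto simp: sg_edges_def sg_adj_def finite_sg_V)

lemma sg_edges_subset: "sg_edges m \<subseteq> SG \<times> SG"
  using sg_V_subset by (auto simp: sg_edges_def sg_adj_def)

lemma sg_edges_0: "sg_edges 0 = sg_V0 \<times> sg_V0 - Id"
  using sg_V0_subset by (auto simp: sg_edges_def sg_adj_def sg_V_0 sg_words_0 sg_cell_simps)

lemma sg_edges_Suc:
  "sg_edges (Suc m) = (\<Union>i\<in>{0,1,2}. map_prod (sg_F i) (sg_F i) ` sg_edges m)"
proof (intro equalityI subsetI)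
  fix e assume "e \<in> sg_edges (Suc m)"
  then obtain x y w where e: "e = (x, y)" "x \<in> sg_V (Suc m)" "y \<in> sg_V (Suc m)" "x \<noteq> y"
    "w \<in> sg_words (Suc m)" "x \<in> sg_cell w" "y \<in> sg_cell w"
    by (auto simp: sg_edges_def sg_adj_def)
  from e(5) obtain i v where w: "w = i # v" "i \<in> {0,1,2}" "v \<in> sg_words m"
    by (auto simp: sg_words_Suc simp del: insert_iff)
  \<comment> \<open>A vertex lying in the \<open>i\<close>-th cell may have been produced by another
    map \<open>sg_F j\<close>. Then it is a junction point, and its preimage under
    \<open>sg_F i\<close> is \<open>sg_q j\<close>, a vertex of every level.\<close>
  have V: "z' \<in> sg_V m" if z': "sg_F i z' \<in> sg_V (Suc m)" "z' \<in> sg_cell v" for z'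
  proof -
    obtain j z where j: "j \<in> {0,1,2}" "z \<in> sg_V m" "sg_F i z' = sg_F j z"
      using z'(1) unfolding sg_V_Suc_iff by metis
    have "z' \<in> SG" using z'(2) sg_cell_subset w(3) unfolding sg_words_def by blast
    moreover have "z \<in> SG" using j(2) sg_V_subset by blast
    ultimately show ?thesis
      using j sg_F_eq_F[OF w(2) j(1) _ _ _ j(3)] sg_q_in_V[OF j(1)]
      by (cases "i = j") simp_all
  qed
  obtain x' y' where xy: "x = sg_F i x'" "y = sg_F i y'" "x' \<in> sg_cell v" "y' \<in> sg_cell v"
    using e(6,7) unfolding w(1) sg_cell_simps by blast
  then have *: "(x', y') \<in> sg_edges m"
    using V[of x'] V[of y'] e(2-4) w(3) unfolding sg_edges_def sg_adj_def by blast
  have "e \<in> map_prod (sg_F i) (sg_F i) ` sg_edges m"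
    using imageI[OF *, of "map_prod (sg_F i) (sg_F i)"]
    unfolding e(1) xy(1,2) map_prod_simp .
  with w(2) show "e \<in> (\<Union>i\<in>{0,1,2}. map_prod (sg_F i) (sg_F i) ` sg_edges m)"
    by (rule UN_I)
next
  fix e assume "e \<in> (\<Union>i\<in>{0,1,2}. map_prod (sg_F i) (sg_F i) ` sg_edges m)"
  then obtain i where "i \<in> {0,1,2}" "e \<in> map_prod (sg_F i) (sg_F i) ` sg_edges m"
    by (rule UN_E)
  moreover from this(2) obtain x y where "e = (sg_F i x, sg_F i y)" "(x, y) \<in> sg_edges m"
    by auto
  ultimately have "e = (sg_F i x, sg_F i y)" "i \<in> {0,1,2}" "(x, y) \<in> sg_edges m" by auto
  then obtain w where e: "e = (sg_F i x, sg_F i y)" "i \<in> {0,1,2}" "x \<in> sg_V m"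
    "y \<in> sg_V m" "x \<noteq> y" "w \<in> sg_words m" "x \<in> sg_cell w" "y \<in> sg_cell w"
    unfolding sg_edges_def sg_adj_def by blast
  have "i # w \<in> sg_words (Suc m)" using e unfolding sg_words_Suc by blast
  moreover have "sg_F i x \<in> sg_cell (i # w)" "sg_F i y \<in> sg_cell (i # w)"
    using e by (auto simp: sg_cell_simps)
  moreover have "sg_F i x \<in> sg_V (Suc m)" "sg_F i y \<in> sg_V (Suc m)"
    using e unfolding sg_V_Suc by blast+
  ultimately show "e \<in> sg_edges (Suc m)"
    using e unfolding sg_edges_def sg_adj_def by auto
qed

text \<open>An edge has two distinct endpoints, whereas two 1-cells share at most one point.\<close>

lemma sg_edges_disjoint:
  assumes "i \<in> {0,1,2}" "j \<in> {0,1,2}" "i \<noteq> j"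
  shows "map_prod (sg_F i) (sg_F i) ` sg_edges m \<inter> map_prod (sg_F j) (sg_F j) ` sg_edges m = {}"
proof -
  have False if e: "(x, y) \<in> sg_edges m" "(x', y') \<in> sg_edges m" "sg_F i x = sg_F j x'"
    "sg_F i y = sg_F j y'" for x y x' y'
  proof -
    have "x \<in> SG" "y \<in> SG" "x' \<in> SG" "y' \<in> SG" using e sg_edges_subset by auto
    then have "x = sg_q j" "y = sg_q j" using sg_F_eq_F[OF assms] e by auto
    then show False using e(1) by (auto simp: sg_edges_def sg_adj_def)
  qed
  then show ?thesis by auto
qed

subsection \<open>Reflection\<close>

definition sg_R :: "real^2 \<Rightarrow> real^2" where
  "sg_R x = vector [1 - x $ 1, x $ 2]"

definition sg_swap :: "nat \<Rightarrow> nat" where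
  "sg_swap i = (if i = 1 then 2 else if i = 2 then 1 else i)"

lemma sg_swap_mem: "i \<in> {0,1,2} \<Longrightarrow> sg_swap i \<in> {0,1,2}"
  by (auto simp: sg_swap_def)

lemma sg_swap_swap [simp]: "sg_swap (sg_swap i) = i"
  by (auto simp: sg_swap_def)

lemma sg_R_R [simp]: "sg_R (sg_R x) = x"
  by (simp add: sg_R_def vec_eq_iff forall_2)

lemma sg_R_q: "i \<in> {0,1,2} \<Longrightarrow> sg_R (sg_q i) = sg_q (sg_swap i)"
  by (auto simp: sg_R_def sg_swap_def vec_eq_iff forall_2 sg_q_simps)

lemma sg_R_F: "i \<in> {0,1,2} \<Longrightarrow> sg_R (sg_F i x) = sg_F (sg_swap i) (sg_R x)"
  by (auto simp: sg_R_def sg_swap_def vec_eq_iff forall_2 sg_F_alt sg_q_simps field_simps)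

lemma continuous_on_sg_R: "continuous_on S sg_R"
proof -
  have eq: "sg_R = (\<lambda>x. \<chi> i. if i = 1 then 1 - x $ 1 else x $ 2)"
    by (auto simp: sg_R_def vec_eq_iff forall_2)
  have "continuous_on S (\<lambda>x::real^2. if i = (1::2) then 1 - x $ 1 else x $ 2)" for i
    by (cases "i = 1") (auto intro!: continuous_intros)
  then show ?thesis unfolding eq by (rule continuous_on_vec_lambda)
qed

text \<open>The reflection conjugates the three contractions into each other, so the reflected
  gasket is again a nonempty compact fixed point of \<open>gasket_step\<close>, and uniqueness
  applies.\<close>

lemma SG_R: "sg_R ` SG = SG"
proof -
  have swap: "sg_swap ` {0,1,2} = {0,1,2}" by (auto simp: sg_swap_def)
  have "sg_R ` SG = (\<Union>i\<in>{0,1,2}. sg_R ` sg_F i ` SG)"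
    unfolding image_UN[symmetric] SG_eq[symmetric] ..
  also have "\<dots> = (\<Union>i\<in>{0,1,2}. sg_F (sg_swap i) ` sg_R ` SG)"
    by (rule SUP_cong) (simp_all only: image_image sg_R_F)
  also have "\<dots> = (\<Union>i\<in>sg_swap ` {0,1,2}. sg_F i ` sg_R ` SG)"
    by (simp only: image_image)
  finally have a: "sg_R ` SG = gasket_step (sg_R ` SG)"
    unfolding gasket_step_def swap .
  have b: "SG = gasket_step SG" unfolding gasket_step_def by (rule SG_eq)
  have c: "compact (sg_R ` SG)"
    by (intro compact_continuous_image continuous_on_sg_R compact_SG)
  have d: "sg_R ` SG \<noteq> {}" using SG_nonempty by simp
  show ?thesis
    by (rule subset_antisym[OF gasket_unique[OF c d a compact_SG SG_nonempty b]
          gasket_unique[OF compact_SG SG_nonempty b c d a]])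
qed

lemma sg_R_in_SG [simp]: "sg_R x \<in> SG \<longleftrightarrow> x \<in> SG"
  using SG_R by (metis image_eqI sg_R_R)

lemma sg_R_V0 [simp]: "sg_R x \<in> sg_V0 \<longleftrightarrow> x \<in> sg_V0"
proof -
  have "sg_R x \<in> sg_V0" if "x \<in> sg_V0" for x
    using that by (auto simp: sg_V0_def sg_R_q sg_swap_def)
  then show ?thesis by (metis sg_R_R)
qed

lemma sg_R_F0_pow: "sg_R ((sg_F 0 ^^ m) x) = (sg_F 0 ^^ m) (sg_R x)"
  by (induction m) (simp_all add: sg_R_F sg_swap_def)

lemma sg_R_Fw: "set w \<subseteq> {0,1,2} \<Longrightarrow> sg_R (sg_Fw w x) = sg_Fw (map sg_swap w) (sg_R x)"
proof (induction w)
  case (Cons i w)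
  then have "i \<in> {0,1,2}" "set w \<subseteq> {0,1,2}" unfolding set_simps by blast+
  then show ?case using Cons.IH by (simp only: sg_Fw_simps o_apply list.map sg_R_F)
qed simp

lemma bij_betw_swap_words: "bij_betw (map sg_swap) (sg_words m) (sg_words m)"
proof (rule bij_betwI[where g = "map sg_swap"])
  show "map sg_swap \<in> sg_words m \<rightarrow> sg_words m"
  proof
    fix w assume "w \<in> sg_words m"
    then show "map sg_swap w \<in> sg_words m"
      unfolding sg_words_def mem_Collect_eq length_map set_map
      by (meson image_subsetI sg_swap_mem subsetD)
  qed
  then show "map sg_swap \<in> sg_words m \<rightarrow> sg_words m" .
qed (simp_all add: o_def)

section \<open>The energy form\<close>

lemma energy_level_alt:
  "energy_level m u v = (5/3) ^ m / 2 * (\<Sum>(x, y)\<in>sg_edges m. (u x - u y) * (v x - v y))"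
  by (simp add: energy_level_def sg_edges_def power_int_minus flip: power_inverse)

lemma energy_level_cong:
  assumes "\<And>x. x \<in> SG \<Longrightarrow> u x = u' x" "\<And>x. x \<in> SG \<Longrightarrow> v x = v' x"
  shows "energy_level m u v = energy_level m u' v'"
proof -
  have "(\<Sum>(x, y)\<in>sg_edges m. (u x - u y) * (v x - v y)) =
      (\<Sum>(x, y)\<in>sg_edges m. (u' x - u' y) * (v' x - v' y))"
    using sg_edges_subset[of m] assms by (intro sum.cong refl) (auto simp: subset_iff)
  then show ?thesis by (simp add: energy_level_alt)
qed

lemma energy_level_commute: "energy_level m u v = energy_level m v u"
  by (simp add: energy_level_alt mult.commute)

lemma energy_level_linear:
  "energy_level m (\<lambda>x. a * u x + b * u' x) v = a * energy_level m u v + b * energy_level m u' v"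
proof -
  have "(\<Sum>(x, y)\<in>sg_edges m. ((a * u x + b * u' x) - (a * u y + b * u' y)) * (v x - v y)) =
    a * (\<Sum>(x, y)\<in>sg_edges m. (u x - u y) * (v x - v y)) +
    b * (\<Sum>(x, y)\<in>sg_edges m. (u' x - u' y) * (v x - v y))"
    unfolding sum_distrib_left sum.distrib[symmetric]
    by (intro sum.cong refl) (auto simp: algebra_simps)
  then show ?thesis by (simp add: energy_level_alt algebra_simps)
qed

lemma energy_level_linear_right:
  "energy_level m v (\<lambda>x. a * u x + b * u' x) = a * energy_level m v u + b * energy_level m v u'"
  unfolding energy_level_commute[of m v "\<lambda>x. a * u x + b * u' x"]
    energy_level_commute[of m v u] energy_level_commute[of m v u']
  by (rule energy_level_linear)

text \<open>The written-out factors \<open>1\<close> and \<open>-1\<close> make the arguments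
  literal instances of \<open>a * u x + b * v x\<close>, the shape of all the linearity lemmas. The
  same device recurs below.\<close>

lemma energy_level_polarize:
  "energy_level m u v = (energy_level m (\<lambda>x. 1 * u x + 1 * v x) (\<lambda>x. 1 * u x + 1 * v x)
     - energy_level m (\<lambda>x. 1 * u x + (-1) * v x) (\<lambda>x. 1 * u x + (-1) * v x)) / 4"
  unfolding energy_level_linear[of m 1 u 1 v] energy_level_linear[of m 1 u "-1" v]
    energy_level_linear_right[of m _ 1 u 1 v] energy_level_linear_right[of m _ 1 u "-1" v]
    energy_level_commute[of m v u] by simp

section \<open>Self-similarity and monotonicity of the energy\<close>

lemma energy_level_Suc:
  "energy_level (Suc m) u v =
     5/3 * (\<Sum>i\<in>{0,1,2}. energy_level m (u \<circ> sg_F i) (v \<circ> sg_F i))"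
proof -
  let ?g = "\<lambda>(x, y). (u x - u y) * (v x - v y)"
  have "sum ?g (sg_edges (Suc m)) =
      (\<Sum>i\<in>{0,1,2}. sum ?g (map_prod (sg_F i) (sg_F i) ` sg_edges m))"
    unfolding sg_edges_Suc
  proof (rule sum.UNION_disjoint)
    show "\<forall>i\<in>{0,1,2}. finite (map_prod (sg_F i) (sg_F i) ` sg_edges m)"
      by (simp add: finite_sg_edges)
    show "\<forall>i\<in>{0,1,2}. \<forall>j\<in>{0,1,2}. i \<noteq> j \<longrightarrow> map_prod (sg_F i) (sg_F i) ` sg_edges m
        \<inter> map_prod (sg_F j) (sg_F j) ` sg_edges m = {}"
      using sg_edges_disjoint by (intro ballI impI)
  qed simp
  also have "\<dots> = (\<Sum>i\<in>{0,1,2}. sum (?g \<circ> map_prod (sg_F i) (sg_F i)) (sg_edges m))"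
    by (intro sum.cong refl sum.reindex) (auto simp: inj_on_def)
  also have "\<dots> = (\<Sum>i\<in>{0,1,2}. \<Sum>(x, y)\<in>sg_edges m.
      ((u \<circ> sg_F i) x - (u \<circ> sg_F i) y) * ((v \<circ> sg_F i) x - (v \<circ> sg_F i) y))"
    by (intro sum.cong refl) auto
  finally show ?thesis
    unfolding energy_level_alt sum_distrib_left[symmetric] by simp
qed

lemma sg_q_distinct: "sg_q 0 \<noteq> sg_q 1" "sg_q 0 \<noteq> sg_q 2" "sg_q 1 \<noteq> sg_q 2"
  using bary_q[of 0 0] bary_q[of 0 1] bary_q[of 0 2] bary_q[of 1 1] bary_q[of 1 2] by auto

lemma energy_level_0:
  "energy_level 0 u v = (u (sg_q 0) - u (sg_q 1)) * (v (sg_q 0) - v (sg_q 1))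
     + (u (sg_q 0) - u (sg_q 2)) * (v (sg_q 0) - v (sg_q 2))
     + (u (sg_q 1) - u (sg_q 2)) * (v (sg_q 1) - v (sg_q 2))"
proof -
  have "sg_edges 0 = {(sg_q 0, sg_q 1), (sg_q 1, sg_q 0), (sg_q 0, sg_q 2), (sg_q 2, sg_q 0),
      (sg_q 1, sg_q 2), (sg_q 2, sg_q 1)}"
    unfolding sg_edges_0 sg_V0_def using sg_q_distinct by auto
  then show ?thesis
    using sg_q_distinct sg_q_distinct[symmetric] by (simp add: energy_level_alt algebra_simps)
qed

lemma energy_level_nonneg: "0 \<le> energy_level m u u"
  unfolding energy_level_alt by (intro mult_nonneg_nonneg sum_nonneg) auto

text \<open>Here \<open>a\<close>, \<open>b\<close>, \<open>c\<close> are the values at the corners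
  and \<open>x\<close>, \<open>y\<close>, \<open>z\<close> those at the midpoints of the sides
  opposite to them. Subdivision can lower the minimal graph energy only by the factor 3/5, which the
  renormalization undoes.\<close>

lemma renormalization_inequality:
  fixes a b c x y z :: real
  shows "(a-b)^2 + (a-c)^2 + (b-c)^2 \<le> 5/3 * ((a-z)^2 + (a-y)^2 + (z-y)^2
     + ((z-b)^2 + (z-x)^2 + (b-x)^2) + ((y-x)^2 + (y-c)^2 + (x-c)^2))"
proof -
  \<comment> \<open>Five times the deviations from the harmonic extension, whose value at a midpoint
    is 2/5 of each adjacent corner plus 1/5 of the opposite one. The energy difference is a positive
    quadratic form in these deviations.\<close>
  define X Y Z where XYZ: "X = 5 * x - (a + 2*b + 2*c)" "Y = 5 * y - (b + 2*a + 2*c)"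
    "Z = 5 * z - (c + 2*a + 2*b)"
  have "25 * 5 * ((a-z)^2 + (a-y)^2 + (z-y)^2 + ((z-b)^2 + (z-x)^2 + (b-x)^2)
      + ((y-x)^2 + (y-c)^2 + (x-c)^2)) - 75 * ((a-b)^2 + (a-c)^2 + (b-c)^2)
    = 5 * (2 * X^2 + 2 * Y^2 + 2 * Z^2 + (X - Y)^2 + (X - Z)^2 + (Y - Z)^2)"
    unfolding XYZ by algebra
  moreover have "5 * (2 * X^2 + 2 * Y^2 + 2 * Z^2 + (X - Y)^2 + (X - Z)^2 + (Y - Z)^2) \<ge> 0"
    by simp
  moreover have "T \<le> 5/3 * S" if "25 * 5 * S - 75 * T = 5 * Q" "0 \<le> 5 * Q" for S T Q :: real
    using that by simp
  ultimately show ?thesis by blast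
qed

text \<open>Only the first subdivision needs the inequality; higher levels follow by
  self-similarity, and this is why \<open>u\<close> varies in the induction.\<close>

lemma energy_level_mono: "energy_level m u u \<le> energy_level (Suc m) u u"
proof (induction m arbitrary: u)
  case 0
  have "sg_F 1 (sg_q 0) = sg_F 0 (sg_q 1)" "sg_F 2 (sg_q 0) = sg_F 0 (sg_q 2)"
    "sg_F 2 (sg_q 1) = sg_F 1 (sg_q 2)" by (auto intro: sg_F_q_swap)
  then show ?case
    using renormalization_inequality[of "u (sg_q 0)" "u (sg_q 1)" "u (sg_q 2)"
        "u (sg_F 0 (sg_q 1))" "u (sg_F 0 (sg_q 2))" "u (sg_F 1 (sg_q 2))"]
    by (simp add: energy_level_Suc energy_level_0 power2_eq_square)
next
  case (Suc m)
  then show ?case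
    unfolding energy_level_Suc[of m] energy_level_Suc[of "Suc m"]
    by (intro mult_left_mono sum_mono) auto
qed

lemma energy_level_Lipschitz:
  assumes "\<And>x y. x \<in> SG \<Longrightarrow> y \<in> SG \<Longrightarrow> \<bar>v x - v y\<bar> \<le> \<bar>u x - u y\<bar>"
  shows "energy_level m v v \<le> energy_level m u u"
proof -
  have "(v x - v y) * (v x - v y) \<le> (u x - u y) * (u x - u y)" if "x \<in> SG" "y \<in> SG" for x y
    using power_mono[OF assms[OF that], of 2] by (simp add: power2_eq_square)
  then show ?thesis
    unfolding energy_level_alt using sg_edges_subset[of m]
    by (intro mult_left_mono sum_mono) auto
qed

text \<open>The parallelogram identity with the nonnegative energy of the difference
  dropped.\<close>

lemma energy_level_sum_le:
  "energy_level m (\<lambda>x. a * u x + b * v x) (\<lambda>x. a * u x + b * v x)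
     \<le> 2 * a^2 * energy_level m u u + 2 * b^2 * energy_level m v v"
proof -
  have "energy_level m (\<lambda>x. a * u x + b * v x) (\<lambda>x. a * u x + b * v x)
      + energy_level m (\<lambda>x. a * u x + (-b) * v x) (\<lambda>x. a * u x + (-b) * v x)
    = 2 * a^2 * energy_level m u u + 2 * b^2 * energy_level m v v"
    unfolding energy_level_linear[of m a u b v] energy_level_linear[of m a u "-b" v]
      energy_level_linear_right[of m _ a u b v] energy_level_linear_right[of m _ a u "-b" v]
    by (simp add: algebra_simps power2_eq_square)
  then show ?thesis
    using energy_level_nonneg[of m "\<lambda>x. a * u x + (-b) * v x"] by linarith
qed

text \<open>The levels increase, so a uniform bound already forces convergence. Membership in the
  domain is always shown through this criterion or by invariance of the levels.\<close>

lemma dom_energyI: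
  assumes "continuous_on SG u" "\<And>m. energy_level m u u \<le> B"
  shows "u \<in> dom_energy"
proof -
  have "incseq (\<lambda>m. energy_level m u u)" by (intro incseq_SucI energy_level_mono)
  then obtain L where "(\<lambda>m. energy_level m u u) \<longlonglongrightarrow> L"
    using assms(2) by (rule incseq_convergent[OF _ allI])
  then have "convergent (\<lambda>m. energy_level m u u)" by (rule convergentI)
  then show ?thesis using assms(1) by (simp add: dom_energy_def)
qed

lemma dom_energyE:
  assumes "u \<in> dom_energy"
  obtains B where "\<And>m. energy_level m u u \<le> B"
proof -
  have "Bseq (\<lambda>m. energy_level m u u)"
    using assms by (simp add: dom_energy_def convergent_imp_Bseq)
  then obtain B where "\<And>m. norm (energy_level m u u) \<le> B" by (metis BseqE)
  then show ?thesis using that[of B] by (simp add: abs_le_iff)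
qed

lemma dom_energy_continuous: "u \<in> dom_energy \<Longrightarrow> continuous_on SG u"
  by (simp add: dom_energy_def)

lemma dom_energy_cong:
  assumes "\<And>x. x \<in> SG \<Longrightarrow> u x = u' x"
  shows "u \<in> dom_energy \<longleftrightarrow> u' \<in> dom_energy"
proof -
  have "energy_level m u u = energy_level m u' u'" for m
    by (rule energy_level_cong) (use assms in auto)
  then show ?thesis
    unfolding dom_energy_def using continuous_on_cong[of SG SG u u'] assms by simp
qed

lemma dom_energy_linear:
  assumes "u \<in> dom_energy" "v \<in> dom_energy"
  shows "(\<lambda>x. a * u x + b * v x) \<in> dom_energy"
proof -
  obtain A B where AB: "\<And>m. energy_level m u u \<le> A" "\<And>m. energy_level m v v \<le> B"
    using dom_energyE[OF assms(1)] dom_energyE[OF assms(2)] by metis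
  show ?thesis
  proof (rule dom_energyI)
    show "continuous_on SG (\<lambda>x. a * u x + b * v x)"
      using assms[THEN dom_energy_continuous] by (intro continuous_intros)
    show "energy_level m (\<lambda>x. a * u x + b * v x) (\<lambda>x. a * u x + b * v x)
        \<le> 2 * a^2 * A + 2 * b^2 * B" for m
      using energy_level_sum_le[of m a u b v] mult_left_mono[OF AB(1)[of m], of "2 * a^2"]
        mult_left_mono[OF AB(2)[of m], of "2 * b^2"] by simp
  qed
qed

lemma dom_energy_const: "(\<lambda>x. c) \<in> dom_energy"
  by (rule dom_energyI[of _ 0]) (auto simp: energy_level_alt)

text \<open>The domain provides convergence on the diagonal only. Polarization extends it to pairs,
  so that the \<open>lim\<close> in \<open>energy\<close> is a genuine limit.\<close>

lemma energy_tendsto: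
  assumes "u \<in> dom_energy" "v \<in> dom_energy"
  shows "(\<lambda>m. energy_level m u v) \<longlonglongrightarrow> energy u v"
proof -
  have "convergent (\<lambda>m. energy_level m (\<lambda>x. 1 * u x + c * v x) (\<lambda>x. 1 * u x + c * v x))" for c
    using dom_energy_linear[OF assms, of 1 c] by (simp add: dom_energy_def)
  from convergent_diff[OF this[of 1] this[of "-1"]] obtain L where "(\<lambda>m.
      energy_level m (\<lambda>x. 1 * u x + 1 * v x) (\<lambda>x. 1 * u x + 1 * v x)
      - energy_level m (\<lambda>x. 1 * u x + (-1) * v x) (\<lambda>x. 1 * u x + (-1) * v x)) \<longlonglongrightarrow> L"
    by (auto dest: convergentD)
  from tendsto_divide[OF this tendsto_const[of 4]] have "convergent (\<lambda>m. energy_level m u v)"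
    unfolding energy_level_polarize[of _ u v] by (auto intro: convergentI)
  then show ?thesis unfolding energy_def by (simp add: convergent_LIMSEQ_iff)
qed

lemma energy_linear:
  assumes "u \<in> dom_energy" "u' \<in> dom_energy" "v \<in> dom_energy"
  shows "energy (\<lambda>x. a * u x + b * u' x) v = a * energy u v + b * energy u' v"
proof -
  have "(\<lambda>m. a * energy_level m u v + b * energy_level m u' v)
      \<longlonglongrightarrow> a * energy u v + b * energy u' v"
    using assms by (intro tendsto_intros energy_tendsto)
  moreover have "(\<lambda>m. a * energy_level m u v + b * energy_level m u' v)
      \<longlonglongrightarrow> energy (\<lambda>x. a * u x + b * u' x) v"
    using energy_tendsto[OF dom_energy_linear[OF assms(1,2), of a b] assms(3)]
    unfolding energy_level_linear .
  ultimately show ?thesis by (rule LIMSEQ_unique[symmetric])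
qed

lemma energy_cong:
  assumes "\<And>x. x \<in> SG \<Longrightarrow> u x = u' x" "\<And>x. x \<in> SG \<Longrightarrow> v x = v' x"
  shows "energy u v = energy u' v'"
  unfolding energy_def using energy_level_cong[of u u' v v'] assms by presburger

lemma energy_level_R: "energy_level m (u \<circ> sg_R) (v \<circ> sg_R) = energy_level m u v"
proof (induction m arbitrary: u v)
  case 0
  then show ?case
    by (simp add: energy_level_0 sg_R_q sg_swap_def algebra_simps)
next
  case (Suc m)
  have "w \<circ> sg_R \<circ> sg_F i = (w \<circ> sg_F (sg_swap i)) \<circ> sg_R"
    if "i \<in> {0,1,2}" for i and w :: "real^2 \<Rightarrow> real"
    using sg_R_F[OF that] by (simp only: fun_eq_iff o_apply) simp
  then have "energy_level m (u \<circ> sg_R \<circ> sg_F i) (v \<circ> sg_R \<circ> sg_F i) =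
      energy_level m (u \<circ> sg_F (sg_swap i)) (v \<circ> sg_F (sg_swap i))" if "i \<in> {0,1,2}" for i
    using that Suc by metis
  then show ?case unfolding energy_level_Suc by (simp add: sg_swap_def)
qed

lemma dom_energy_R:
  assumes "u \<in> dom_energy" shows "u \<circ> sg_R \<in> dom_energy"
proof -
  have "continuous_on SG (u \<circ> sg_R)"
    using dom_energy_continuous[OF assms] by (intro continuous_on_compose continuous_on_sg_R) (simp add: SG_R)
  then show ?thesis using assms by (simp add: dom_energy_def energy_level_R)
qed

lemma energy_R: "energy (u \<circ> sg_R) (v \<circ> sg_R) = energy u v"
  by (simp add: energy_def energy_level_R)

subsection \<open>Localized functions of finite energy\<close>

text \<open>A copy of \<open>h\<close> in one 1-cell, extended by zero. The pieces fit together at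
  the junction points when \<open>h\<close> vanishes on \<open>sg_V0\<close>, which the lemmas about
  other cells therefore assume.\<close>

definition sg_lift :: "nat \<Rightarrow> (real^2 \<Rightarrow> real) \<Rightarrow> real^2 \<Rightarrow> real" where
  "sg_lift i h x = (if x \<in> sg_F i ` SG then h (sg_Finv i x) else 0)"

lemma sg_lift_F_same: "x \<in> SG \<Longrightarrow> sg_lift i h (sg_F i x) = h x"
  by (simp add: sg_lift_def)

lemma sg_lift_F_other:
  assumes "i \<in> {0,1,2}" "j \<in> {0,1,2}" "i \<noteq> j" "x \<in> SG" "\<And>y. y \<in> sg_V0 \<Longrightarrow> h y = 0"
  shows "sg_lift i h (sg_F j x) = 0"
proof (cases "sg_F j x \<in> sg_F i ` SG")
  case True
  then obtain y where y: "y \<in> SG" "sg_F j x = sg_F i y" by blast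
  then have "y = sg_q j" using sg_F_eq_F[OF assms(1-3) y(1) assms(4)] by simp
  then show ?thesis using y assms(2,5) by (auto simp: sg_lift_def sg_V0_def)
qed (simp add: sg_lift_def)

lemma sg_lift_V0:
  assumes "i \<in> {0,1,2}" "\<And>y. y \<in> sg_V0 \<Longrightarrow> h y = 0" "x \<in> sg_V0"
  shows "sg_lift i h x = 0"
proof -
  obtain j where j: "j \<in> {0,1,2}" "x = sg_F j (sg_q j)" using assms(3) unfolding sg_V0_def by auto
  show ?thesis
  proof (cases "i = j")
    case True
    then have "sg_lift i h x = h (sg_q j)" using sg_lift_F_same[OF sg_q_in_SG[OF j(1)]] j(2) by metis
    then show ?thesis using j(1) assms(2)[of "sg_q j"] by (auto simp: sg_V0_def)
  next
    case False
    then show ?thesis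
      unfolding j(2) using sg_q_in_SG[OF j(1)] assms(2) by (rule sg_lift_F_other[OF assms(1) j(1)])
  qed
qed

text \<open>Only one of the three summands in the self-similarity formula survives. Continuity holds
  on each of the three closed 1-cells, hence on their union.\<close>

lemma sg_lift_dom_energy:
  assumes i: "i \<in> {0,1,2}" and h: "h \<in> dom_energy" "\<And>y. y \<in> sg_V0 \<Longrightarrow> h y = 0"
  shows "sg_lift i h \<in> dom_energy"
proof -
  have same: "energy_level m (sg_lift i h \<circ> sg_F i) (sg_lift i h \<circ> sg_F i) = energy_level m h h" for m
    by (rule energy_level_cong) (auto simp: sg_lift_F_same)
  have other: "energy_level m (sg_lift i h \<circ> sg_F j) (sg_lift i h \<circ> sg_F j) = 0"
    if "j \<in> {0,1,2}" "i \<noteq> j" for m j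
  proof -
    have "energy_level m (sg_lift i h \<circ> sg_F j) (sg_lift i h \<circ> sg_F j)
        = energy_level m (\<lambda>_. 0) (\<lambda>_. 0)"
      using sg_lift_F_other[of i j _ h] that i h(2)
      by (intro energy_level_cong) (metis o_apply)+
    then show ?thesis by (simp add: energy_level_alt)
  qed
  have Suc: "energy_level (Suc m) (sg_lift i h) (sg_lift i h) = 5/3 * energy_level m h h" for m
  proof -
    have "(\<Sum>j\<in>{0,1,2}. energy_level m (sg_lift i h \<circ> sg_F j) (sg_lift i h \<circ> sg_F j))
        = (\<Sum>j\<in>{0,1,2}. if j = i then energy_level m h h else 0)"
      using same other by (intro sum.cong refl) auto
    also have "\<dots> = energy_level m h h" using i by (simp only: sum.delta finite.intros) simp
    finally show ?thesis unfolding energy_level_Suc by simp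
  qed
  have "closed (sg_F j ` SG)" for j
    by (intro compact_imp_closed compact_continuous_image continuous_intros compact_SG)
  moreover have "continuous_on (sg_F j ` SG) (sg_lift i h)" if j: "j \<in> {0,1,2}" for j
  proof (cases "j = i")
    case True
    have "continuous_on (sg_F i ` SG) (\<lambda>x. h (sg_Finv i x))"
      using dom_energy_continuous[OF h(1)]
      by (rule continuous_on_compose2) (auto simp: sg_Finv_def[abs_def] sg_F_alt intro!: continuous_intros)
    then show ?thesis using True
      by (subst continuous_on_cong[OF refl]) (auto simp: sg_lift_def)
  next
    case False
    have "continuous_on (sg_F j ` SG) (sg_lift i h) \<longleftrightarrow> continuous_on (sg_F j ` SG) (\<lambda>_. 0 :: real)"
      using sg_lift_F_other[OF i j] False h(2) by (intro continuous_on_cong) auto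
    then show ?thesis by simp
  qed
  ultimately have "continuous_on (\<Union>j\<in>{0,1,2}. sg_F j ` SG) (sg_lift i h)"
    by (intro continuous_on_closed_Union) simp_all
  then have "continuous_on SG (sg_lift i h)" unfolding SG_eq[symmetric] .
  moreover obtain B where B: "\<And>m. energy_level m h h \<le> B" using h(1) dom_energyE by blast
  \<comment> \<open>The formula \<open>Suc\<close> says nothing about level 0; bounding each level
    by the next one treats all levels alike.\<close>
  moreover have "energy_level m (sg_lift i h) (sg_lift i h) \<le> 5/3 * B" for m
    using energy_level_mono[of m "sg_lift i h"] Suc[of m] B[of m] by linarith
  ultimately show ?thesis by (intro dom_energyI)
qed

text \<open>The letters of \<open>w\<close> are peeled off from the outside: a bump for the shorter
  word is copied into one more 1-cell by \<open>sg_lift\<close>, which preserves all the required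
  properties.\<close>

lemma bump_exists:
  assumes h: "h \<in> dom_energy" "\<And>y. y \<in> sg_V0 \<Longrightarrow> h y = 0" "\<And>x. x \<in> SG \<Longrightarrow> 0 \<le> h x"
    "x0 \<in> SG" "h x0 \<noteq> 0"
    and w: "set w \<subseteq> {0,1,2}"
  shows "\<exists>v\<in>dom_energy. (\<forall>y\<in>sg_V0. v y = 0) \<and> (\<forall>x\<in>SG. 0 \<le> v x) \<and>
    (\<forall>x\<in>SG - sg_cell w. v x = 0) \<and> (\<exists>x\<in>SG. v x \<noteq> 0)"
  using w
proof (induction w)
  case Nil
  then show ?case using h by (auto simp: sg_cell_simps)
next
  case (Cons i w)
  then have i: "i \<in> {0,1,2}" and "set w \<subseteq> {0,1,2}" unfolding set_simps by blast+
  then obtain v where v: "v \<in> dom_energy" "\<forall>y\<in>sg_V0. v y = 0" "\<forall>x\<in>SG. 0 \<le> v x"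
    "\<forall>x\<in>SG - sg_cell w. v x = 0" "\<exists>x\<in>SG. v x \<noteq> 0"
    using Cons.IH by blast
  from v(5) obtain z where "z \<in> SG" "v z \<noteq> 0" by blast
  then have "sg_F i z \<in> SG" "sg_lift i v (sg_F i z) \<noteq> 0"
    using sg_F_in_SG[OF i] by (auto simp: sg_lift_F_same)
  moreover have "sg_lift i v x = 0" if "x \<in> SG - sg_cell (i # w)" for x
    using that v(4) by (auto simp: sg_lift_def sg_cell_simps)
  moreover have "0 \<le> sg_lift i v x" for x
    using v(3) by (auto simp: sg_lift_def)
  moreover have "sg_lift i v y = 0" if "y \<in> sg_V0" for y
    using sg_lift_V0[OF i] v(2) that by blast
  moreover have "sg_lift i v \<in> dom_energy"
    using sg_lift_dom_energy[OF i v(1)] v(2) by blast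
  ultimately show ?case by (intro bexI[of _ "sg_lift i v"]) auto
qed

section \<open>Integration of continuous functions over the gasket\<close>

lemma ex_cell: "x \<in> SG \<Longrightarrow> \<exists>w\<in>sg_words m. x \<in> sg_cell w"
  unfolding SG_eq_cells[of m] by (rule UN_iff[THEN iffD1])

lemma small_cell:
  assumes "x \<in> SG" "0 < e"
  obtains w where "set w \<subseteq> {0,1,2}" "x \<in> sg_cell w" "\<And>y. y \<in> sg_cell w \<Longrightarrow> dist y x < e"
proof -
  obtain B where B: "\<And>y z. y \<in> SG \<Longrightarrow> z \<in> SG \<Longrightarrow> dist y z \<le> B"
    using compact_imp_bounded[OF compact_SG] unfolding bounded_two_points by metis
  obtain m where m: "B / e < 2 ^ m" using real_arch_pow[of 2 "B / e"] by auto
  obtain w where w: "w \<in> sg_words m" "x \<in> sg_cell w" using ex_cell[OF assms(1)] by blast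
  have "dist y x < e" if "y \<in> sg_cell w" for y
  proof -
    obtain a b where ab: "a \<in> SG" "b \<in> SG" "y = sg_Fw w a" "x = sg_Fw w b"
      using \<open>y \<in> sg_cell w\<close> w(2) by (auto simp: sg_cell_def)
    then have "dist y x = dist a b / 2 ^ m"
      using w(1) by (simp add: dist_norm norm_sg_Fw_diff sg_words_def)
    also have "\<dots> \<le> B / 2 ^ m" using B ab by (intro divide_right_mono) auto
    also have "\<dots> < e" using m assms(2) by (simp add: field_simps)
    finally show ?thesis .
  qed
  moreover have "set w \<subseteq> {0,1,2}" using w(1) by (simp only: sg_words_def mem_Collect_eq)
  ultimately show ?thesis using w(2) by (intro that)
qed

locale sg_measure =
  fixes \<mu> :: "(real^2) measure"
  assumes is_sg_measure: "is_sg_measure \<mu>"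
begin

sublocale prob_space \<mu>
  using is_sg_measure by (simp add: is_sg_measure_def)

lemma sets_mu [measurable_cong]: "sets \<mu> = sets borel"
  using is_sg_measure by (simp add: is_sg_measure_def)

lemma space_mu: "space \<mu> = UNIV"
  using sets_eq_imp_space_eq[OF sets_mu] by simp

lemma measure_cell: "set w \<subseteq> {0,1,2} \<Longrightarrow> measure \<mu> (sg_cell w) = (1/3) ^ length w"
  using is_sg_measure unfolding is_sg_measure_def by blast

lemma cell_sets: "sg_cell w \<in> sets \<mu>"
  unfolding sets_mu using compact_sg_cell by (rule borel_compact)

lemma SG_sets: "SG \<in> sets \<mu>"
  using cell_sets[of "[]"] by (simp add: sg_cell_simps)

lemma measure_SG: "measure \<mu> SG = 1"
  using measure_cell[of "[]"] by (simp add: sg_cell_simps)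

definition sg_int :: "(real^2 \<Rightarrow> real) \<Rightarrow> real" where
  "sg_int f = (LINT x:SG|\<mu>. f x)"

lemma set_integrable_SG:
  fixes f :: "real^2 \<Rightarrow> real"
  assumes "continuous_on SG f" shows "set_integrable \<mu> SG f"
proof -
  have meas: "(\<lambda>x. indicator SG x *\<^sub>R f x) \<in> borel_measurable \<mu>"
    using borel_measurable_continuous_on_indicator[OF _ assms] SG_sets sets_mu
    by (simp cong: measurable_cong_sets)
  have "bounded (f ` SG)"
    using assms compact_SG by (intro compact_imp_bounded compact_continuous_image)
  then obtain B where B: "\<And>x. x \<in> SG \<Longrightarrow> norm (f x) \<le> B" by (auto simp: bounded_iff)
  have "norm (indicator SG x *\<^sub>R f x) \<le> \<bar>B\<bar>" for x
    using B[of x] by (cases "x \<in> SG") auto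
  then show ?thesis unfolding set_integrable_def
    by (intro integrable_const_bound[of _ "\<bar>B\<bar>"] AE_I2 meas)
qed

lemma sg_int_cong: "(\<And>x. x \<in> SG \<Longrightarrow> f x = g x) \<Longrightarrow> sg_int f = sg_int g"
  unfolding sg_int_def by (rule set_lebesgue_integral_cong) (use SG_sets in auto)

lemma sg_int_linear:
  assumes "continuous_on SG f" "continuous_on SG g"
  shows "sg_int (\<lambda>x. a * f x + b * g x) = a * sg_int f + b * sg_int g"
proof -
  have "set_integrable \<mu> SG (\<lambda>x. a * f x)" "set_integrable \<mu> SG (\<lambda>x. b * g x)"
    using assms by (auto intro!: set_integrable_SG continuous_intros)
  then show ?thesis unfolding sg_int_def by (simp add: set_integral_add)
qed

lemma sg_int_scale: "sg_int (\<lambda>x. a * f x) = a * sg_int f"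
  unfolding sg_int_def by simp

lemma sg_int_zero: "sg_int (\<lambda>x. 0) = 0"
  unfolding sg_int_def by simp

text \<open>By continuity \<open>f\<close> stays above \<open>f x / 2\<close> on a whole small cell
  around \<open>x\<close>, and every cell has positive measure.\<close>

lemma sg_int_pos:
  assumes f: "continuous_on SG f" "\<And>x. x \<in> SG \<Longrightarrow> 0 \<le> f x" and x: "x \<in> SG" "f x \<noteq> 0"
  shows "0 < sg_int f"
proof -
  have fx: "0 < f x" using f(2)[OF x(1)] x(2) by simp
  then obtain e where e: "0 < e" "\<And>y. y \<in> SG \<Longrightarrow> dist y x < e \<Longrightarrow> dist (f y) (f x) < f x / 2"
    using f(1) x(1) unfolding continuous_on_iff by (metis half_gt_zero)
  obtain w where w: "set w \<subseteq> {0,1,2}" "x \<in> sg_cell w" "\<And>y. y \<in> sg_cell w \<Longrightarrow> dist y x < e"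
    using small_cell[OF x(1) e(1)] by metis
  have "f x / 2 * indicator (sg_cell w) y \<le> indicator SG y *\<^sub>R f y" for y
  proof (cases "y \<in> sg_cell w")
    case True
    then have "y \<in> SG" using sg_cell_subset[OF w(1)] by blast
    moreover have "dist (f y) (f x) < f x / 2" using e(2)[OF \<open>y \<in> SG\<close> w(3)[OF True]] .
    moreover from this have "f x / 2 \<le> f y" 
      unfolding dist_real_def using abs_ge_minus_self[of "f y - f x"] by linarith
    ultimately show ?thesis using True by simp
  next
    case False
    then show ?thesis using f(2)[of y] by (cases "y \<in> SG") auto
  qed
  moreover have "integrable \<mu> (\<lambda>y. f x / 2 * indicator (sg_cell w) y)"
    using cell_sets by (intro integrable_mult_right integrable_real_indicator) (auto simp: emeasure_eq_measure)
  ultimately have "(\<integral>y. f x / 2 * indicator (sg_cell w) y \<partial>\<mu>) \<le> sg_int f"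
    unfolding sg_int_def set_lebesgue_integral_def
    using set_integrable_SG[OF f(1)] unfolding set_integrable_def by (intro integral_mono) auto
  moreover have "(\<integral>y. f x / 2 * indicator (sg_cell w) y \<partial>\<mu>) = f x / 2 * (1/3) ^ length w"
    using measure_cell[OF w(1)] cell_sets by (simp add: space_mu)
  moreover have "0 < f x / 2 * (1/3) ^ length w" using fx by simp
  ultimately show ?thesis by linarith
qed

section \<open>The integral as a limit of averages over vertices\<close>

text \<open>A point of the gasket lies in cells of arbitrarily small measure; a point outside it has
  no mass left, as the gasket already carries mass 1. This makes the overlaps of cells null.\<close>

lemma measure_singleton: "measure \<mu> {x} = 0"
proof (cases "x \<in> SG")
  case True
  have "measure \<mu> {x} \<le> (1/3) ^ m" for m
  proof -
    obtain w where w: "w \<in> sg_words m" "x \<in> sg_cell w" using ex_cell[OF True] by blast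
    have "measure \<mu> {x} \<le> measure \<mu> (sg_cell w)"
      using w(2) by (intro finite_measure_mono cell_sets) auto
    also have "\<dots> = (1/3) ^ m" using measure_cell w(1) unfolding sg_words_def by blast
    finally show ?thesis .
  qed
  moreover have "(\<lambda>m. (1/3::real) ^ m) \<longlonglongrightarrow> 0" by (intro LIMSEQ_realpow_zero) auto
  ultimately have "measure \<mu> {x} \<le> 0" by (intro LIMSEQ_le_const[of _ 0]) auto
  then show ?thesis using measure_nonneg[of \<mu> "{x}"] by linarith
next
  case False
  then have "measure \<mu> ({x} \<union> SG) = measure \<mu> {x} + measure \<mu> SG"
    using SG_sets by (intro finite_measure_Union) (auto simp: sets_mu)
  then show ?thesis using measure_SG prob_le_1[of "{x} \<union> SG"] measure_nonneg[of \<mu> "{x}"] by linarith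
qed

lemma sg_int_cells:
  assumes "continuous_on SG f"
  shows "sg_int f = (\<Sum>w\<in>sg_words m. LINT x:sg_cell w|\<mu>. f x)"
proof -
  have sub: "sg_cell w \<subseteq> SG" if "w \<in> sg_words m" for w
    using sg_cell_subset that unfolding sg_words_def by blast
  have "AE x in \<mu>. \<not> (x \<in> sg_cell w \<inter> sg_cell w')"
    if w: "w \<in> sg_words m" "w' \<in> sg_words m" "w \<noteq> w'" for w w'
  proof -
    have "\<exists>z. sg_cell w \<inter> sg_cell w' \<subseteq> {z}"
      using w unfolding sg_words_def by (intro sg_cells_inter) simp_all
    then obtain z where "sg_cell w \<inter> sg_cell w' \<subseteq> {z}" ..
    moreover have "AE x in \<mu>. x \<notin> {z}"
      using measure_singleton[of z] by (intro AE_not_in) (auto simp: null_sets_def sets_mu emeasure_eq_measure)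
    ultimately show ?thesis by (auto elim!: AE_mp)
  qed
  then have ae: "AE x in \<mu>. (x \<in> sg_cell w \<and> x \<in> sg_cell w') \<longrightarrow> w = w'"
    if "w \<in> sg_words m" "w' \<in> sg_words m" for w w'
    using that by (cases "w = w'") auto
  have int: "set_integrable \<mu> (sg_cell w) f" if "w \<in> sg_words m" for w
    using set_integrable_SG[OF assms] cell_sets sub[OF that] by (rule set_integrable_subset)
  have "(LINT x:(\<Union>w\<in>sg_words m. sg_cell w)|\<mu>. f x) = (\<Sum>w\<in>sg_words m. LINT x:sg_cell w|\<mu>. f x)"
    by (rule set_integral_finite_UN_AE[OF finite_sg_words ae cell_sets int])
  then show ?thesis unfolding sg_int_def SG_eq_cells[of m, symmetric] .
qed

lemma set_integral_bound:
  assumes "set_integrable \<mu> A f" "A \<in> sets \<mu>" "\<And>x. x \<in> A \<Longrightarrow> \<bar>f x\<bar> \<le> e"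
  shows "\<bar>LINT x:A|\<mu>. f x\<bar> \<le> e * measure \<mu> A"
proof -
  have "integrable \<mu> (\<lambda>x. e * indicator A x)"
    using assms(2) by (intro integrable_mult_right integrable_real_indicator) (auto simp: emeasure_eq_measure)
  then have "norm (LINT x:A|\<mu>. f x) \<le> (\<integral>x. e * indicator A x \<partial>\<mu>)"
    using assms(1,3) unfolding set_lebesgue_integral_def set_integrable_def
    by (intro Bochner_Integration.integral_norm_bound_integral) (auto simp: indicator_def)
  then show ?thesis using assms(2) by (simp add: space_mu)
qed

text \<open>These Riemann sums show that the cell masses determine the integral, which replaces a
  change of variables under the reflection. The sample point \<open>sg_q 0\<close> is chosen because
  the reflection fixes it.\<close>

lemma sg_int_LIMSEQ:
  assumes f: "continuous_on SG f"
  shows "(\<lambda>m. (1/3) ^ m * (\<Sum>w\<in>sg_words m. f (sg_Fw w (sg_q 0)))) \<longlonglongrightarrow> sg_int f"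
proof (rule LIMSEQ_I)
  fix r :: real assume r: "0 < r"
  have "uniformly_continuous_on SG f" using f compact_SG by (rule compact_uniformly_continuous)
  then obtain d where d: "0 < d"
    "\<And>x y. x \<in> SG \<Longrightarrow> y \<in> SG \<Longrightarrow> dist x y < d \<Longrightarrow> dist (f x) (f y) < r / 2"
    using r unfolding uniformly_continuous_on_def by (metis half_gt_zero)
  obtain B where B: "\<And>y z. y \<in> SG \<Longrightarrow> z \<in> SG \<Longrightarrow> dist y z \<le> B"
    using compact_imp_bounded[OF compact_SG] unfolding bounded_two_points by metis
  obtain m0 where m0: "B / d < 2 ^ m0" using real_arch_pow[of 2 "B / d"] by auto
  have "\<bar>(1/3) ^ m * (\<Sum>w\<in>sg_words m. f (sg_Fw w (sg_q 0))) - sg_int f\<bar> < r" if m: "m \<ge> m0" for m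
  proof -
    have cell: "\<bar>(LINT x:sg_cell w|\<mu>. f x) - (1/3) ^ m * f (sg_Fw w (sg_q 0))\<bar> \<le> r / 2 * (1/3) ^ m"
      if w: "w \<in> sg_words m" for w
    proof -
      let ?c = "f (sg_Fw w (sg_q 0))"
      have sw: "set w \<subseteq> {0,1,2}" "length w = m" using w unfolding sg_words_def by blast+
      have q: "sg_q 0 \<in> SG" by (rule sg_q_in_SG) simp
      have int: "set_integrable \<mu> (sg_cell w) g" if "continuous_on SG g" for g :: "real^2 \<Rightarrow> real"
        using set_integrable_SG[OF that] cell_sets sg_cell_subset[OF sw(1)] by (rule set_integrable_subset)
      have "\<bar>f x - ?c\<bar> \<le> r / 2" if "x \<in> sg_cell w" for x
      proof -
        obtain y where y: "y \<in> SG" "x = sg_Fw w y" using \<open>x \<in> sg_cell w\<close> by (auto simp: sg_cell_def)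
        have "dist x (sg_Fw w (sg_q 0)) = dist y (sg_q 0) / 2 ^ m"
          using sw(2) y(2) by (simp add: dist_norm norm_sg_Fw_diff)
        also have "\<dots> \<le> B / 2 ^ m" using B y q by (intro divide_right_mono) auto
        also have "\<dots> < d"
        proof -
          have "B / d < 2 ^ m" using m0 power_increasing[OF m, of "2::real"] by linarith
          then show ?thesis using d(1) by (simp add: field_simps)
        qed
        finally show ?thesis
          using d(2)[of x "sg_Fw w (sg_q 0)"] sg_Fw_in_SG[OF sw(1)] y q
          by (simp add: dist_real_def)
      qed
      then have "\<bar>LINT x:sg_cell w|\<mu>. f x - ?c\<bar> \<le> r / 2 * measure \<mu> (sg_cell w)"
        using f by (intro set_integral_bound int cell_sets continuous_intros)
      moreover have "(LINT x:sg_cell w|\<mu>. f x - ?c) =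
          (LINT x:sg_cell w|\<mu>. f x) - (LINT x:sg_cell w|\<mu>. ?c)"
        using f by (intro set_integral_diff int continuous_intros)
      moreover have "(LINT x:sg_cell w|\<mu>. ?c) = measure \<mu> (sg_cell w) * ?c"
        by (simp add: set_lebesgue_integral_def space_mu cell_sets)
      ultimately show ?thesis using measure_cell[OF sw(1)] sw(2) by simp
    qed
    have "\<bar>(1/3) ^ m * (\<Sum>w\<in>sg_words m. f (sg_Fw w (sg_q 0))) - sg_int f\<bar>
        = \<bar>\<Sum>w\<in>sg_words m. (LINT x:sg_cell w|\<mu>. f x) - (1/3) ^ m * f (sg_Fw w (sg_q 0))\<bar>"
      unfolding sg_int_cells[OF f, of m] by (simp add: sum_subtractf sum_distrib_left abs_minus_commute)
    also have "\<dots> \<le> (\<Sum>w\<in>sg_words m. r / 2 * (1/3) ^ m)"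
      by (rule order_trans[OF sum_abs]) (intro sum_mono cell)
    also have "\<dots> = r / 2" by (simp add: card_sg_words power_divide)
    finally show ?thesis using r by simp
  qed
  then show "\<exists>m0. \<forall>m\<ge>m0. norm ((1/3) ^ m * (\<Sum>w\<in>sg_words m. f (sg_Fw w (sg_q 0))) - sg_int f) < r"
    by auto
qed

text \<open>On each level the reflection merely permutes the words, so the Riemann sums of
  \<open>f\<close> and of its reflection coincide.\<close>

lemma sg_int_R:
  assumes "continuous_on SG f" shows "sg_int (f \<circ> sg_R) = sg_int f"
proof -
  have "continuous_on SG (f \<circ> sg_R)"
    using assms by (intro continuous_on_compose continuous_on_sg_R) (simp add: SG_R)
  note lim = sg_int_LIMSEQ[OF this]
  have "(\<Sum>w\<in>sg_words m. (f \<circ> sg_R) (sg_Fw w (sg_q 0))) = (\<Sum>w\<in>sg_words m. f (sg_Fw w (sg_q 0)))" for m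
  proof -
    have "(\<Sum>w\<in>sg_words m. (f \<circ> sg_R) (sg_Fw w (sg_q 0)))
        = (\<Sum>w\<in>sg_words m. f (sg_Fw (map sg_swap w) (sg_q 0)))"
    proof (rule sum.cong[OF refl])
      fix w assume "w \<in> sg_words m"
      then have "set w \<subseteq> {0,1,2}" unfolding sg_words_def by blast
      moreover have "sg_R (sg_q 0) = sg_q 0" by (simp add: sg_R_q sg_swap_def)
      ultimately show "(f \<circ> sg_R) (sg_Fw w (sg_q 0)) = f (sg_Fw (map sg_swap w) (sg_q 0))"
        using sg_R_Fw[of w "sg_q 0"] by (simp only: o_apply)
    qed
    also have "\<dots> = (\<Sum>w\<in>sg_words m. f (sg_Fw w (sg_q 0)))"
      by (rule sum.reindex_bij_betw[OF bij_betw_swap_words])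
    finally show ?thesis .
  qed
  then show ?thesis using LIMSEQ_unique[OF lim] sg_int_LIMSEQ[OF assms] by simp
qed

lemma sg_int_swap:
  assumes K: "continuous_on (SG \<times> SG) (\<lambda>(x, y). K x y)"
  shows "sg_int (\<lambda>x. sg_int (\<lambda>y. K x y)) = sg_int (\<lambda>y. sg_int (\<lambda>x. K x y))"
proof -
  interpret P: pair_prob_space \<mu> \<mu> ..
  let ?k = "\<lambda>p. indicator (SG \<times> SG) p *\<^sub>R (\<lambda>(x, y). K x y) p"
  have comp: "compact (SG \<times> SG)" by (intro compact_Times compact_SG)
  have "sets (\<mu> \<Otimes>\<^sub>M \<mu>) = sets borel"
    unfolding sets_pair_measure_cong[OF sets_mu sets_mu] borel_prod ..
  then have meas: "?k \<in> borel_measurable (\<mu> \<Otimes>\<^sub>M \<mu>)"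
    using borel_measurable_continuous_on_indicator[OF borel_compact[OF comp] K]
    by (simp cong: measurable_cong_sets)
  have "bounded ((\<lambda>(x, y). K x y) ` (SG \<times> SG))"
    using K comp by (intro compact_imp_bounded compact_continuous_image)
  then obtain B where B: "\<And>p. p \<in> SG \<times> SG \<Longrightarrow> norm ((\<lambda>(x, y). K x y) p) \<le> B"
    by (metis bounded_iff imageI)
  have "norm (?k p) \<le> \<bar>B\<bar>" for p
    using B[of p] by (cases "p \<in> SG \<times> SG") (auto simp: indicator_def)
  then have "integrable (\<mu> \<Otimes>\<^sub>M \<mu>) ?k"
    by (intro P.integrable_const_bound[of _ "\<bar>B\<bar>"] AE_I2 meas)
  then have "integrable (\<mu> \<Otimes>\<^sub>M \<mu>) (\<lambda>(x, y). indicator SG x * (indicator SG y * K x y))"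
    by (rule Bochner_Integration.integrable_cong[THEN iffD1, rotated -1])
      (auto simp: indicator_def)
  from P.Fubini_integral[OF this] show ?thesis
    by (simp add: sg_int_def set_lebesgue_integral_def mult.left_commute[of "indicator SG _" "indicator SG _"]
      flip: integral_mult_right_zero)
qed

end

section \<open>The Laplacian\<close>

context sg_measure
begin

lemma has_laplacian_iff:
  "has_laplacian \<mu> u f \<longleftrightarrow> u \<in> dom_energy \<and> continuous_on SG f \<and>
     (\<forall>v\<in>dom_energy. (\<forall>x\<in>sg_V0. v x = 0) \<longrightarrow> energy u v = - sg_int (\<lambda>x. f x * v x))"
  by (simp add: has_laplacian_def sg_int_def)

lemma has_laplacianD:
  assumes "has_laplacian \<mu> u f"
  shows "u \<in> dom_energy" "continuous_on SG u" "continuous_on SG f"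
    "\<And>v. v \<in> dom_energy \<Longrightarrow> (\<And>x. x \<in> sg_V0 \<Longrightarrow> v x = 0) \<Longrightarrow>
       energy u v = - sg_int (\<lambda>x. f x * v x)"
  using assms dom_energy_continuous by (auto simp: has_laplacian_iff)

lemma has_laplacianI:
  assumes "u \<in> dom_energy" "continuous_on SG f"
    "\<And>v. v \<in> dom_energy \<Longrightarrow> (\<And>x. x \<in> sg_V0 \<Longrightarrow> v x = 0) \<Longrightarrow>
       energy u v = - sg_int (\<lambda>x. f x * v x)"
  shows "has_laplacian \<mu> u f"
  using assms by (auto simp: has_laplacian_iff)

lemma has_laplacian_cong:
  assumes "has_laplacian \<mu> u f" "\<And>x. x \<in> SG \<Longrightarrow> u x = u' x" "\<And>x. x \<in> SG \<Longrightarrow> f x = f' x"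
  shows "has_laplacian \<mu> u' f'"
proof (rule has_laplacianI)
  show "u' \<in> dom_energy" using dom_energy_cong[of u u'] has_laplacianD(1)[OF assms(1)] assms(2) by blast
  show "continuous_on SG f'"
    using has_laplacianD(3)[OF assms(1)] continuous_on_cong[of SG SG f f'] assms(3) by simp
  fix v assume v: "v \<in> dom_energy" "\<And>x. x \<in> sg_V0 \<Longrightarrow> v x = 0"
  have "energy u' v = energy u v" using energy_cong[of u' u v v] assms(2) by simp
  also have "\<dots> = - sg_int (\<lambda>x. f x * v x)" using has_laplacianD(4)[OF assms(1)] v .
  also have "\<dots> = - sg_int (\<lambda>x. f' x * v x)"
    using sg_int_cong[of "\<lambda>x. f x * v x" "\<lambda>x. f' x * v x"] assms(3) by simp
  finally show "energy u' v = - sg_int (\<lambda>x. f' x * v x)" .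
qed

lemma has_laplacian_linear:
  assumes u: "has_laplacian \<mu> u f" and u': "has_laplacian \<mu> u' f'"
  shows "has_laplacian \<mu> (\<lambda>x. a * u x + b * u' x) (\<lambda>x. a * f x + b * f' x)"
proof (rule has_laplacianI)
  note D = has_laplacianD[OF u] and D' = has_laplacianD[OF u']
  show "(\<lambda>x. a * u x + b * u' x) \<in> dom_energy" by (intro dom_energy_linear D(1) D'(1))
  show "continuous_on SG (\<lambda>x. a * f x + b * f' x)" by (intro continuous_intros D(3) D'(3))
  fix v assume v: "v \<in> dom_energy" "\<And>x. x \<in> sg_V0 \<Longrightarrow> v x = 0"
  have "energy (\<lambda>x. a * u x + b * u' x) v = a * energy u v + b * energy u' v"
    by (intro energy_linear D(1) D'(1) v(1))
  also have "\<dots> = - (a * sg_int (\<lambda>x. f x * v x) + b * sg_int (\<lambda>x. f' x * v x))"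
    using D(4)[OF v] D'(4)[OF v] by simp
  also have "a * sg_int (\<lambda>x. f x * v x) + b * sg_int (\<lambda>x. f' x * v x)
      = sg_int (\<lambda>x. a * (f x * v x) + b * (f' x * v x))"
    by (intro sg_int_linear[symmetric] continuous_intros D(3) D'(3) dom_energy_continuous v(1))
  finally show "energy (\<lambda>x. a * u x + b * u' x) v = - sg_int (\<lambda>x. (a * f x + b * f' x) * v x)"
    by (simp add: algebra_simps)
qed

lemma has_laplacian_const: "has_laplacian \<mu> (\<lambda>x. c) (\<lambda>x. 0)"
proof (rule has_laplacianI)
  show "energy (\<lambda>x. c) v = - sg_int (\<lambda>x. 0 * v x)" for v
    by (simp add: energy_def energy_level_alt sg_int_zero)
qed (auto simp: dom_energy_const)

lemma has_laplacian_R: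
  assumes u: "has_laplacian \<mu> u f" shows "has_laplacian \<mu> (u \<circ> sg_R) (f \<circ> sg_R)"
proof (rule has_laplacianI)
  note D = has_laplacianD[OF u]
  show "u \<circ> sg_R \<in> dom_energy" by (intro dom_energy_R D(1))
  show "continuous_on SG (f \<circ> sg_R)"
    using D(3) by (intro continuous_on_compose continuous_on_sg_R) (simp add: SG_R)
  fix v assume v: "v \<in> dom_energy" "\<And>x. x \<in> sg_V0 \<Longrightarrow> v x = 0"
  have "energy (u \<circ> sg_R) v = energy u (v \<circ> sg_R)"
    using energy_R[of u "v \<circ> sg_R"] by (simp add: o_def)
  also have "\<dots> = - sg_int (\<lambda>x. f x * (v \<circ> sg_R) x)"
    using v by (intro D(4) dom_energy_R) simp_all
  also have "sg_int (\<lambda>x. f x * (v \<circ> sg_R) x) = sg_int ((\<lambda>x. f x * (v \<circ> sg_R) x) \<circ> sg_R)"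
    by (intro sg_int_R[symmetric] continuous_intros D(3) dom_energy_continuous dom_energy_R v(1))
  finally show "energy (u \<circ> sg_R) v = - sg_int (\<lambda>x. (f \<circ> sg_R) x * v x)" by (simp add: o_def)
qed

end

section \<open>Normal and tangential derivatives at the boundary\<close>

lemma has_normal_deriv_linear:
  assumes "has_normal_deriv u i d" "has_normal_deriv u' i d'"
  shows "has_normal_deriv (\<lambda>x. a * u x + b * u' x) i (a * d + b * d')"
  using tendsto_add[OF tendsto_mult_left[of _ _ _ a] tendsto_mult_left[of _ _ _ b]] assms
  unfolding has_normal_deriv_def by (fastforce simp: algebra_simps)

lemma has_tangential_deriv_linear:
  assumes "has_tangential_deriv u i d" "has_tangential_deriv u' i d'"
  shows "has_tangential_deriv (\<lambda>x. a * u x + b * u' x) i (a * d + b * d')"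
  using tendsto_add[OF tendsto_mult_left[of _ _ _ a] tendsto_mult_left[of _ _ _ b]] assms
  unfolding has_tangential_deriv_def by (fastforce simp: algebra_simps)

lemma sg_F0_pow_q_in_SG: "(sg_F 0 ^^ m) (sg_q (Suc 0)) \<in> SG" "(sg_F 0 ^^ m) (sg_q 2) \<in> SG"
  "sg_q 0 \<in> SG"
  by (intro sg_F_pow_in_SG sg_q_in_SG; simp)+

lemma has_normal_deriv_cong:
  assumes "has_normal_deriv u 0 d" "\<And>x. x \<in> SG \<Longrightarrow> u x = u' x"
  shows "has_normal_deriv u' 0 d"
  using assms sg_F0_pow_q_in_SG[unfolded numeral_2_eq_2] by (simp add: has_normal_deriv_def)

lemma has_tangential_deriv_cong:
  assumes "has_tangential_deriv u 0 d" "\<And>x. x \<in> SG \<Longrightarrow> u x = u' x"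
  shows "has_tangential_deriv u' 0 d"
  using assms sg_F0_pow_q_in_SG[unfolded numeral_2_eq_2] by (simp add: has_tangential_deriv_def)

lemma has_normal_deriv_const: "has_normal_deriv (\<lambda>x. c) i 0"
  by (simp add: has_normal_deriv_def)

lemma has_tangential_deriv_const: "has_tangential_deriv (\<lambda>x. c) i 0"
  by (simp add: has_tangential_deriv_def)

lemma has_normal_deriv_R:
  assumes "has_normal_deriv u 0 d" shows "has_normal_deriv (u \<circ> sg_R) 0 d"
  using assms by (simp add: has_normal_deriv_def sg_R_F0_pow sg_R_q sg_swap_def numeral_2_eq_2 algebra_simps)

lemma has_tangential_deriv_R:
  assumes "has_tangential_deriv u 0 d" shows "has_tangential_deriv (u \<circ> sg_R) 0 (- d)"
  using tendsto_minus[OF assms[unfolded has_tangential_deriv_def]]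
  by (simp add: has_tangential_deriv_def sg_R_F0_pow sg_R_q sg_swap_def numeral_2_eq_2 algebra_simps)

text \<open>Monomials of all three families are at hand because the three \<open>P 0 i\<close>
  together span the harmonic functions, and \<open>P 0 2\<close> is the source of the bump
  functions.\<close>

locale sg_setting = sg_measure +
  fixes G :: "real^2 \<Rightarrow> real^2 \<Rightarrow> real" and P :: "nat \<Rightarrow> nat \<Rightarrow> real^2 \<Rightarrow> real"
  assumes green: "is_green \<mu> G"
    and monomial: "\<And>j i. i \<in> {1,2,3} \<Longrightarrow> is_monomial \<mu> j i (P j i)"
begin

lemma P_dom_laplacian: "i \<in> {1,2,3} \<Longrightarrow> P j i \<in> dom_laplacian \<mu>"
  using monomial[of i j] unfolding is_monomial_def by (metis funpow_0 le0)

lemma P_jet: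
  assumes "i \<in> {1,2,3}"
  shows "P j i (sg_q 0) = of_bool (0 = j) * of_bool (i = 1)"
    "has_normal_deriv (P j i) 0 (of_bool (0 = j) * of_bool (i = 2))"
    "has_tangential_deriv (P j i) 0 (of_bool (0 = j) * of_bool (i = 3))"
  using monomial[OF assms, of j] unfolding is_monomial_def by (metis funpow_0 le0)+

lemma P_dom_energy: "i \<in> {1,2,3} \<Longrightarrow> P j i \<in> dom_energy"
  using P_dom_laplacian[of i j] by (auto simp: dom_laplacian_def has_laplacian_def)

text \<open>Since \<open>P\<^sub>0\<^sub>2\<close> has a nonzero normal derivative at \<open>q\<^sub>0\<close>, it takes values other than its three
  boundary values; the distance to those is a bump function.\<close>

lemma base_bump:
  obtains h x0 where "h \<in> dom_energy" "\<And>y. y \<in> sg_V0 \<Longrightarrow> h y = 0" "\<And>x. x \<in> SG \<Longrightarrow> (0::real) \<le> h x"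
    "x0 \<in> SG" "h x0 \<noteq> 0"
proof -
  define u where "u = P 0 2"
  have u: "u \<in> dom_energy" "has_normal_deriv u 0 1" "continuous_on SG u"
    using P_dom_energy[of 2 0] P_jet(2)[of 2 0] dom_energy_continuous by (auto simp: u_def)
  define h where "h x = infdist (u x) (u ` sg_V0)" for x
  have V0: "finite (u ` sg_V0)" "u ` sg_V0 \<noteq> {}" by (auto simp: sg_V0_def)
  have "h \<in> dom_energy"
  proof -
    have "continuous_on SG h" unfolding h_def by (intro continuous_intros u(3))
    moreover have "\<bar>h x - h y\<bar> \<le> \<bar>u x - u y\<bar>" for x y
      using infdist_triangle_abs[of "u x" "u ` sg_V0" "u y"] by (simp add: h_def dist_real_def)
    then have "energy_level m h h \<le> energy_level m u u" for m
      by (intro energy_level_Lipschitz)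
    moreover obtain B where "\<And>m. energy_level m u u \<le> B" using dom_energyE[OF u(1)] by metis
    ultimately show ?thesis by (meson dom_energyI order_trans)
  qed
  moreover have "h y = 0" if "y \<in> sg_V0" for y
    using that by (simp add: h_def)
  moreover have "0 \<le> h x" for x by (simp add: h_def infdist_nonneg)
  moreover have "\<exists>x0\<in>SG. h x0 \<noteq> 0"
  proof (rule ccontr)
    assume "\<not> ?thesis"
    then have fin: "u x \<in> u ` sg_V0" if "x \<in> SG" for x
      using in_closed_iff_infdist_zero[OF finite_imp_closed[OF V0(1)] V0(2)] that by (simp add: h_def)
    \<comment> \<open>Otherwise \<open>u\<close> takes only finitely many values on the gasket. By
      continuity it then equals \<open>u (sg_q 0)\<close> exactly at the points approaching
      \<open>sg_q 0\<close>, which makes the normal derivative 0 instead of 1.\<close>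
    have ev: "\<forall>\<^sub>F m in sequentially. u ((sg_F 0 ^^ m) z) = u (sg_q 0)" if z: "z \<in> SG" for z
    proof -
      have lim: "(\<lambda>m. u ((sg_F 0 ^^ m) z)) \<longlonglongrightarrow> u (sg_q 0)"
        using continuous_on_tendsto_compose[OF u(3) sg_F_pow_tendsto sg_F0_pow_q_in_SG(3)]
          sg_F_pow_in_SG[OF _ z] by simp
      have "open (- (u ` sg_V0 - {u (sg_q 0)}))"
        using V0(1) by (intro open_Compl finite_imp_closed) simp
      from topological_tendstoD[OF lim this]
      have "\<forall>\<^sub>F m in sequentially. u ((sg_F 0 ^^ m) z) \<in> - (u ` sg_V0 - {u (sg_q 0)})" by simp
      then show ?thesis
        by (rule eventually_mono) (use fin sg_F_pow_in_SG[OF _ z] in auto)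
    qed
    have "sg_q (0 + 1) \<in> SG" "sg_q (0 + 2) \<in> SG" by (intro sg_q_in_SG; simp)+
    note ev = this[THEN ev]
    have "\<forall>\<^sub>F m in sequentially. (5/3) ^ m * (2 * u (sg_q 0) - u ((sg_F 0 ^^ m) (sg_q (0 + 1)))
        - u ((sg_F 0 ^^ m) (sg_q (0 + 2)))) = 0"
      using ev by eventually_elim simp
    then have "has_normal_deriv u 0 0"
      unfolding has_normal_deriv_def by (rule tendsto_eventually)
    then have "(0::real) = 1"
      using u(2) unfolding has_normal_deriv_def by (rule LIMSEQ_unique)
    then show False by simp
  qed
  ultimately show ?thesis using that by metis
qed

section \<open>Uniqueness of the Laplacian and of Dirichlet solutions\<close>

text \<open>If \<open>f\<close> and \<open>g\<close> differ at \<open>x\<close>, their difference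
  \<open>D\<close> keeps its sign on a small cell, and a bump supported there has a nonzero integral
  against it. Multiplying by \<open>D x\<close> avoids distinguishing the two signs.\<close>

lemma has_laplacian_unique:
  assumes f: "has_laplacian \<mu> u f" and g: "has_laplacian \<mu> u g" and x: "x \<in> SG"
  shows "f x = g x"
proof (rule ccontr)
  assume ne: "f x \<noteq> g x"
  define D where "D y = f y - g y" for y
  have contD: "continuous_on SG D"
    unfolding D_def by (intro continuous_intros has_laplacianD(3)[OF f] has_laplacianD(3)[OF g])
  have "0 < D x * D x" using ne unfolding D_def by (metis eq_iff_diff_eq_0 not_real_square_gt_zero)
  moreover have "continuous_on SG (\<lambda>y. D x * D y)" by (intro continuous_intros contD)
  ultimately obtain e where e: "0 < e" "\<And>y. y \<in> SG \<Longrightarrow> dist y x < e \<Longrightarrow> dist (D x * D y) (D x * D x) < D x * D x"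
    using x unfolding continuous_on_iff by metis
  obtain w where w: "set w \<subseteq> {0,1,2}" "x \<in> sg_cell w" "\<And>y. y \<in> sg_cell w \<Longrightarrow> dist y x < e"
    using small_cell[OF x e(1)] by metis
  have pos: "0 < D x * D y" if "y \<in> sg_cell w" for y
  proof -
    have "y \<in> SG" using that sg_cell_subset[OF w(1)] by blast
    then have "\<bar>D x * D y - D x * D x\<bar> < D x * D x" using e(2) w(3)[OF that] by (simp add: dist_real_def)
    then show ?thesis by linarith
  qed
  obtain h x0 where "h \<in> dom_energy" "\<And>y. y \<in> sg_V0 \<Longrightarrow> h y = 0" "\<And>x. x \<in> SG \<Longrightarrow> 0 \<le> h x"
    "x0 \<in> SG" "h x0 \<noteq> 0" using base_bump by metis
  from bump_exists[OF this w(1)] obtain v z where v: "v \<in> dom_energy" "\<forall>y\<in>sg_V0. v y = 0"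
    "\<forall>x\<in>SG. 0 \<le> v x" "\<forall>x\<in>SG - sg_cell w. v x = 0" "z \<in> SG" "v z \<noteq> 0"
    by blast
  have contv: "continuous_on SG v" by (rule dom_energy_continuous[OF v(1)])
  have "0 < sg_int (\<lambda>y. D x * D y * v y)"
  proof (rule sg_int_pos[OF _ _ v(5)])
    show "continuous_on SG (\<lambda>y. D x * D y * v y)" by (intro continuous_intros contD contv)
    show "0 \<le> D x * D y * v y" if "y \<in> SG" for y
      using v(3,4) that pos[of y] by (cases "y \<in> sg_cell w") (auto simp: less_imp_le)
    have "z \<in> sg_cell w" using v(4-6) by blast
    then show "D x * D z * v z \<noteq> 0" using pos[of z] v(6) by auto
  qed
  moreover have "sg_int (\<lambda>y. D x * D y * v y) = sg_int (\<lambda>y. D x * (f y * v y) + (- D x) * (g y * v y))"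
    by (simp add: D_def algebra_simps)
  moreover have "\<dots> = D x * sg_int (\<lambda>y. f y * v y) + (- D x) * sg_int (\<lambda>y. g y * v y)"
    by (intro sg_int_linear continuous_intros contv has_laplacianD(3)[OF f] has_laplacianD(3)[OF g])
  moreover have "sg_int (\<lambda>y. f y * v y) = sg_int (\<lambda>y. g y * v y)"
    using has_laplacianD(4)[OF f v(1)] has_laplacianD(4)[OF g v(1)] v(2) by simp
  ultimately show False by simp
qed

abbreviation L :: "(real^2 \<Rightarrow> real) \<Rightarrow> real^2 \<Rightarrow> real" where "L \<equiv> laplacian \<mu>"

lemma has_laplacian_L:
  assumes "has_laplacian \<mu> u f" shows "has_laplacian \<mu> u (L u)"
proof -
  let ?Q = "\<lambda>f. has_laplacian \<mu> u f \<and> (\<forall>x. x \<notin> SG \<longrightarrow> f x = 0)"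
  have "?Q (\<lambda>x. if x \<in> SG then f x else 0)"
    using has_laplacian_cong[OF assms, of u "\<lambda>x. if x \<in> SG then f x else 0"] by simp
  moreover have "g = g'" if "?Q g" "?Q g'" for g g'
    using that has_laplacian_unique[of u g g'] by (intro ext) metis
  ultimately have "\<exists>!f. ?Q f" by blast
  from theI'[OF this] show ?thesis unfolding laplacian_def by blast
qed

lemma L_eq: "has_laplacian \<mu> u f \<Longrightarrow> x \<in> SG \<Longrightarrow> L u x = f x"
  using has_laplacian_unique has_laplacian_L by blast

lemma dom_laplacian_iff: "u \<in> dom_laplacian \<mu> \<longleftrightarrow> has_laplacian \<mu> u (L u)"
  using has_laplacian_L by (auto simp: dom_laplacian_def)

lemma green_iff:
  assumes "continuous_on SG f"
  shows "has_laplacian \<mu> u (\<lambda>x. - f x) \<and> (\<forall>x\<in>sg_V0. u x = 0) \<longleftrightarrow>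
    (\<forall>x\<in>SG. u x = (LINT y:SG|\<mu>. G x y * f y))"
  using green assms unfolding is_green_def by blast

text \<open>The difference solves the problem with zero data, so the Green equivalence represents it
  as the integral of zero. The form \<open>- 0\<close> matches the sign in
  \<open>is_green\<close>.\<close>

lemma Dirichlet_unique:
  assumes u: "has_laplacian \<mu> u f" and u': "has_laplacian \<mu> u' f"
    and V0: "\<And>x. x \<in> sg_V0 \<Longrightarrow> u x = u' x" and x: "x \<in> SG"
  shows "u x = u' x"
proof -
  let ?w = "\<lambda>x. 1 * u x + (-1) * u' x"
  have "has_laplacian \<mu> ?w (\<lambda>x. - 0)"
    using has_laplacian_linear[OF u u', of 1 "-1"] by (rule has_laplacian_cong) simp_all
  moreover have "\<forall>x\<in>sg_V0. ?w x = 0" using V0 by simp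
  ultimately have w: "has_laplacian \<mu> ?w (\<lambda>x. - 0) \<and> (\<forall>x\<in>sg_V0. ?w x = 0)" ..
  have "\<forall>x\<in>SG. ?w x = (LINT y:SG|\<mu>. G x y * 0)"
    using green_iff[of "\<lambda>_. 0" ?w, OF continuous_on_const] w by (rule iffD1)
  then show ?thesis using x by (simp add: set_lebesgue_integral_def)
qed

subsection \<open>Harmonic functions and monomials\<close>

text \<open>The parameters are exactly the value, the normal derivative and the tangential
  derivative at \<open>sg_q 0\<close>. The factor 1 and the grouping fit the binary linearity
  lemmas.\<close>

definition harm :: "real \<Rightarrow> real \<Rightarrow> real \<Rightarrow> real^2 \<Rightarrow> real" where
  "harm a b c x = 1 * (a * P 0 1 x + b * P 0 2 x) + c * P 0 3 x"

lemma has_laplacian_P0: "i \<in> {1,2,3} \<Longrightarrow> has_laplacian \<mu> (P 0 i) (\<lambda>x. 0)"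
proof -
  assume i: "i \<in> {1,2,3}"
  then have a: "has_laplacian \<mu> (P 0 i) (L (P 0 i))" using P_dom_laplacian dom_laplacian_iff by blast
  have "L (P 0 i) x = 0" if "x \<in> SG" for x
    using monomial[OF i, of 0] that by (simp add: is_monomial_def)
  then show ?thesis by (intro has_laplacian_cong[OF a refl])
qed

lemma has_laplacian_harm: "has_laplacian \<mu> (harm a b c) (\<lambda>x. 0)"
  unfolding harm_def
  using has_laplacian_linear[OF has_laplacian_linear[OF has_laplacian_P0[of 1] has_laplacian_P0[of 2], of a b]
      has_laplacian_P0[of 3], of 1 c] by simp

lemma harm_jet:
  "harm a b c (sg_q 0) = a" "has_normal_deriv (harm a b c) 0 b" "has_tangential_deriv (harm a b c) 0 c"
proof -
  show "harm a b c (sg_q 0) = a" using P_jet(1)[of 1 0] P_jet(1)[of 2 0] P_jet(1)[of 3 0] by (simp add: harm_def)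
  show "has_normal_deriv (harm a b c) 0 b"
    using has_normal_deriv_linear[OF has_normal_deriv_linear[OF P_jet(2)[of 1 0] P_jet(2)[of 2 0], of a b]
        P_jet(2)[of 3 0], of 1 c] by (simp add: harm_def[abs_def])
  show "has_tangential_deriv (harm a b c) 0 c"
    using has_tangential_deriv_linear[OF has_tangential_deriv_linear[OF P_jet(3)[of 1 0] P_jet(3)[of 2 0], of a b]
        P_jet(3)[of 3 0], of 1 c] by (simp add: harm_def[abs_def])
qed

lemma harm_eq_0:
  assumes "\<And>x. x \<in> SG \<Longrightarrow> harm a b c x = 0" shows "a = 0" "b = 0" "c = 0"
proof -
  show "a = 0" using harm_jet(1)[of a b c] assms sg_F0_pow_q_in_SG(3) by simp
  have "has_normal_deriv (\<lambda>x. 0) 0 b" using harm_jet(2) by (rule has_normal_deriv_cong) (rule assms)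
  then show "b = 0" using has_normal_deriv_const[of 0] LIMSEQ_unique unfolding has_normal_deriv_def by blast
  have "has_tangential_deriv (\<lambda>x. 0) 0 c" using harm_jet(3) by (rule has_tangential_deriv_cong) (rule assms)
  then show "c = 0" using has_tangential_deriv_const[of 0] LIMSEQ_unique unfolding has_tangential_deriv_def by blast
qed

text \<open>Harmonic functions are determined by their three boundary values, and the three harmonic
  monomials are linearly independent, so they span by a dimension count.\<close>

lemma harmonic_eq_harm:
  assumes h: "has_laplacian \<mu> h (\<lambda>x. 0)"
  obtains a b c where "\<And>x. x \<in> SG \<Longrightarrow> h x = harm a b c x"
proof -
  define \<Phi> :: "real \<times> real \<times> real \<Rightarrow> real \<times> real \<times> real" where
    "\<Phi> = (\<lambda>(a, b, c). (harm a b c (sg_q 0), harm a b c (sg_q 1), harm a b c (sg_q 2)))"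
  have lin: "linear \<Phi>"
    by (rule linearI) (auto simp: \<Phi>_def harm_def algebra_simps)
  moreover have "p = 0" if p: "\<Phi> p = 0" for p
  proof -
    obtain a b c where abc: "p = (a, b, c)" by (cases p)
    have "harm a b c x = 0" if "x \<in> SG" for x
      by (rule Dirichlet_unique[OF has_laplacian_harm has_laplacian_const[of 0] _ that])
        (use p in \<open>auto simp: abc \<Phi>_def sg_V0_def prod_eq_iff\<close>)
    from harm_eq_0[OF this] show ?thesis by (simp add: abc prod_eq_iff)
  qed
  then have "inj \<Phi>" using linear_injective_0[OF lin] by blast
  ultimately have "surj \<Phi>" by (rule linear_injective_imp_surjective) simp
  then obtain a b c where abc: "\<Phi> (a, b, c) = (h (sg_q 0), h (sg_q 1), h (sg_q 2))"
    by (metis prod_cases3 surjD)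
  have "h x = harm a b c x" if "x \<in> SG" for x
    by (rule Dirichlet_unique[OF h has_laplacian_harm _ that]) (use abc in \<open>auto simp: \<Phi>_def sg_V0_def\<close>)
  then show ?thesis by (rule that)
qed

lemma harmonic_eq_0:
  assumes h: "has_laplacian \<mu> h (\<lambda>x. 0)" "h (sg_q 0) = 0" "has_normal_deriv h 0 0"
    "has_tangential_deriv h 0 0" and x: "x \<in> SG"
  shows "h x = 0"
proof -
  obtain a b c where abc: "\<And>x. x \<in> SG \<Longrightarrow> h x = harm a b c x" using harmonic_eq_harm[OF h(1)] by metis
  have "a = 0" using abc[OF sg_F0_pow_q_in_SG(3)] harm_jet(1) h(2) by simp
  moreover have "has_normal_deriv h 0 b" using harm_jet(2) by (rule has_normal_deriv_cong) (simp add: abc)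
  then have "b = 0" using h(3) LIMSEQ_unique unfolding has_normal_deriv_def by blast
  moreover have "has_tangential_deriv h 0 c" using harm_jet(3) by (rule has_tangential_deriv_cong) (simp add: abc)
  then have "c = 0" using h(4) LIMSEQ_unique unfolding has_tangential_deriv_def by blast
  ultimately show ?thesis using abc[OF x] by (simp add: harm_def)
qed

text \<open>Uniqueness for the Cauchy problem at the single vertex \<open>sg_q 0\<close>: the
  difference is harmonic with zero data there.\<close>

lemma jet_unique:
  assumes u: "has_laplacian \<mu> u f" "has_normal_deriv u 0 d" "has_tangential_deriv u 0 t"
    and u': "has_laplacian \<mu> u' f" "has_normal_deriv u' 0 d" "has_tangential_deriv u' 0 t"
    and q: "u (sg_q 0) = u' (sg_q 0)" and x: "x \<in> SG"
  shows "u x = u' x"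
proof -
  have "1 * u x + (-1) * u' x = 0"
  proof (rule harmonic_eq_0[OF _ _ _ _ x])
    show "has_laplacian \<mu> (\<lambda>x. 1 * u x + (-1) * u' x) (\<lambda>x. 0)"
      using has_laplacian_linear[OF u(1) u'(1), of 1 "-1"] by simp
    show "has_normal_deriv (\<lambda>x. 1 * u x + (-1) * u' x) 0 0"
      using has_normal_deriv_linear[OF u(2) u'(2), of 1 "-1"] by simp
    show "has_tangential_deriv (\<lambda>x. 1 * u x + (-1) * u' x) 0 0"
      using has_tangential_deriv_linear[OF u(3) u'(3), of 1 "-1"] by simp
  qed (use q in simp)
  then show ?thesis by simp
qed

section \<open>Uniqueness and parity of the monomials\<close>

lemma is_monomial_jet:
  assumes "is_monomial \<mu> j i u"
  shows "has_laplacian \<mu> u (L u)" "u (sg_q 0) = of_bool (0 = j) * of_bool (i = 1)"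
    "has_normal_deriv u 0 (of_bool (0 = j) * of_bool (i = 2))"
    "has_tangential_deriv u 0 (of_bool (0 = j) * of_bool (i = 3))"
  using assms dom_laplacian_iff unfolding is_monomial_def by (metis funpow_0 le0)+

lemma is_monomial_L:
  assumes "is_monomial \<mu> (Suc j) i u" shows "is_monomial \<mu> j i (L u)"
proof -
  have eq: "(L ^^ n) (L u) = (L ^^ Suc n) u" for n by (simp add: funpow_swap1)
  show ?thesis
    unfolding is_monomial_def eq
  proof (intro conjI allI impI)
    fix n assume "n \<le> j"
    then have n: "Suc n \<le> Suc j" by simp
    show "(L ^^ Suc n) u \<in> dom_laplacian \<mu>" using assms n unfolding is_monomial_def by blast
    have "of_bool (Suc n = Suc j) = (of_bool (n = j) :: real)" by simp
    then show "(L ^^ Suc n) u (sg_q 0) = of_bool (n = j) * of_bool (i = 1)"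
      "has_normal_deriv ((L ^^ Suc n) u) 0 (of_bool (n = j) * of_bool (i = 2))"
      "has_tangential_deriv ((L ^^ Suc n) u) 0 (of_bool (n = j) * of_bool (i = 3))"
      using assms n unfolding is_monomial_def by metis+
  next
    have "(L ^^ (j + 1)) (L u) = (L ^^ (Suc j + 1)) u" by (simp add: eq del: funpow.simps)
    then show "\<forall>x\<in>SG. (L ^^ Suc (j + 1)) u x = 0" using assms unfolding is_monomial_def by simp
  qed
qed

text \<open>Needed to identify \<open>L (P (Suc j) i)\<close> with \<open>P j i\<close>, since the
  former is a priori just some monomial of degree \<open>j\<close>. Inductively the Laplacians
  agree, and so do the data at \<open>sg_q 0\<close>.\<close>

lemma is_monomial_unique:
  assumes "is_monomial \<mu> j i u" "is_monomial \<mu> j i u'" "x \<in> SG"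
  shows "u x = u' x"
  using assms
proof (induction j arbitrary: u u' x)
  case 0
  have harmonic: "has_laplacian \<mu> v (\<lambda>x. 0)" if v: "is_monomial \<mu> 0 i v" for v
    using is_monomial_jet(1)[OF v] by (rule has_laplacian_cong) (use v in \<open>simp_all add: is_monomial_def\<close>)
  then show ?case
    using jet_unique[OF harmonic[OF 0(1)] is_monomial_jet(3,4)[OF 0(1)]
        harmonic[OF 0(2)] is_monomial_jet(3,4)[OF 0(2)] _ 0(3)]
      is_monomial_jet(2)[OF 0(1)] is_monomial_jet(2)[OF 0(2)] by simp
next
  case (Suc j)
  have "L u y = L u' y" if "y \<in> SG" for y
    using Suc.IH[OF is_monomial_L[OF Suc.prems(1)] is_monomial_L[OF Suc.prems(2)] that] .
  then have "has_laplacian \<mu> u' (L u)"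
    using has_laplacian_cong[OF is_monomial_jet(1)[OF Suc.prems(2)]] by simp
  then show ?case
    using jet_unique[OF is_monomial_jet(1,3,4)[OF Suc.prems(1)] _ is_monomial_jet(3,4)[OF Suc.prems(2)] _ Suc.prems(3)]
      is_monomial_jet(2)[OF Suc.prems(1)] is_monomial_jet(2)[OF Suc.prems(2)] by simp
qed

lemma has_laplacian_P_Suc:
  assumes "i \<in> {1,2,3}" shows "has_laplacian \<mu> (P (Suc j) i) (P j i)"
proof -
  note m = monomial[OF assms]
  show ?thesis
    using is_monomial_jet(1)[OF m[of "Suc j"]]
    by (rule has_laplacian_cong) (use is_monomial_unique[OF is_monomial_L[OF m] m] in auto)
qed

text \<open>Reflection fixes \<open>sg_q 0\<close>, keeps the normal derivative there and negates
  the tangential one. Hence both sides solve the same Cauchy problem at that vertex, by induction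
  with the same right-hand side.\<close>

lemma P_reflect:
  assumes k: "k = 2 \<or> k = 3" and x: "x \<in> SG"
  shows "P j k (sg_R x) = (if k = 2 then 1 else -1) * P j k x"
  using x
proof (induction j arbitrary: x)
  let ?e = "if k = 2 then 1 else -1 :: real"
  have k': "k \<in> {1,2,3}" using k by auto
  have step: "(P j k \<circ> sg_R) x = ?e * P j k x + 0 * P j k x"
    if f: "has_laplacian \<mu> (P j k) f" "\<And>x. x \<in> SG \<Longrightarrow> f (sg_R x) = ?e * f x" and x: "x \<in> SG" for j f x
  proof (rule jet_unique[OF _ _ _ _ _ _ _ x])
    note J = P_jet[OF k', of j]
    show "has_laplacian \<mu> (P j k \<circ> sg_R) (f \<circ> sg_R)" by (rule has_laplacian_R[OF f(1)])
    show "has_laplacian \<mu> (\<lambda>x. ?e * P j k x + 0 * P j k x) (f \<circ> sg_R)"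
      using has_laplacian_linear[OF f(1) f(1), of ?e 0]
      by (rule has_laplacian_cong) (simp_all add: f(2))
    show "has_normal_deriv (P j k \<circ> sg_R) 0 (of_bool (0 = j) * of_bool (k = 2))"
      by (rule has_normal_deriv_R[OF J(2)])
    show "has_normal_deriv (\<lambda>x. ?e * P j k x + 0 * P j k x) 0 (of_bool (0 = j) * of_bool (k = 2))"
      using has_normal_deriv_linear[OF J(2) J(2), of ?e 0] k by auto
    show "has_tangential_deriv (P j k \<circ> sg_R) 0 (- (of_bool (0 = j) * of_bool (k = 3)))"
      by (rule has_tangential_deriv_R[OF J(3)])
    show "has_tangential_deriv (\<lambda>x. ?e * P j k x + 0 * P j k x) 0 (- (of_bool (0 = j) * of_bool (k = 3)))"
      using has_tangential_deriv_linear[OF J(3) J(3), of ?e 0] k by auto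
    show "(P j k \<circ> sg_R) (sg_q 0) = ?e * P j k (sg_q 0) + 0 * P j k (sg_q 0)"
      using J(1) k by (auto simp: sg_R_q sg_swap_def)
  qed
  {
    case 0
    then show ?case using step[OF has_laplacian_P0[OF k']] by simp
  next
    case (Suc j)
    then show ?case using step[OF has_laplacian_P_Suc[OF k', of j]] by simp
  }
qed

subsection \<open>The Green operator\<close>

definition T :: "(real^2 \<Rightarrow> real) \<Rightarrow> real^2 \<Rightarrow> real" where
  "T g x = - sg_int (\<lambda>y. G x y * g y)"

lemma T_cong: "(\<And>x. x \<in> SG \<Longrightarrow> g x = g' x) \<Longrightarrow> T g x = T g' x"
  unfolding T_def using sg_int_cong[of "\<lambda>y. G x y * g y" "\<lambda>y. G x y * g' y"] by simp

lemma T_solves: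
  assumes "continuous_on SG g"
  shows "has_laplacian \<mu> (T g) g" "x \<in> sg_V0 \<Longrightarrow> T g x = 0"
proof -
  have "T g x = (LINT y:SG|\<mu>. G x y * (\<lambda>y. - g y) y)" for x
    using sg_int_scale[of "-1" "\<lambda>y. G x y * g y"] by (simp add: T_def sg_int_def)
  moreover have "continuous_on SG (\<lambda>y. - g y)" using assms by (intro continuous_intros)
  ultimately have "has_laplacian \<mu> (T g) (\<lambda>x. - (\<lambda>y. - g y) x) \<and> (\<forall>x\<in>sg_V0. T g x = 0)"
    by (subst green_iff) blast+
  then show "has_laplacian \<mu> (T g) g" "x \<in> sg_V0 \<Longrightarrow> T g x = 0" by simp_all
qed

lemma continuous_on_T: "continuous_on SG g \<Longrightarrow> continuous_on SG (T g)"
  using T_solves(1) has_laplacianD(2) by blast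

text \<open>Fubini for a continuous kernel, followed by the symmetry of \<open>G\<close>.\<close>

lemma T_symmetric:
  assumes g: "continuous_on SG g" and h: "continuous_on SG h"
  shows "sg_int (\<lambda>x. T g x * h x) = sg_int (\<lambda>x. g x * T h x)"
proof -
  have contG: "continuous_on (SG \<times> SG) (\<lambda>(x, y). G x y)" and sym: "\<And>x y. x \<in> SG \<Longrightarrow> y \<in> SG \<Longrightarrow> G x y = G y x"
    using green unfolding is_green_def by blast+
  have "continuous_on (SG \<times> SG) (\<lambda>p. (case p of (x, y) \<Rightarrow> G x y) * (h (fst p) * g (snd p)))"
    by (intro continuous_intros contG continuous_on_compose2[OF g] continuous_on_compose2[OF h]) auto
  then have K: "continuous_on (SG \<times> SG) (\<lambda>(x, y). G x y * (h x * g y))"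
    by (simp add: case_prod_unfold)
  have "sg_int (\<lambda>x. T g x * h x) = sg_int (\<lambda>x. - 1 * sg_int (\<lambda>y. G x y * (h x * g y)))"
  proof (rule sg_int_cong)
    fix x
    have "sg_int (\<lambda>y. G x y * (h x * g y)) = h x * sg_int (\<lambda>y. G x y * g y)"
      unfolding sg_int_scale[symmetric] by (simp add: mult.left_commute)
    then show "T g x * h x = - 1 * sg_int (\<lambda>y. G x y * (h x * g y))" by (simp add: T_def)
  qed
  also have "\<dots> = - sg_int (\<lambda>x. sg_int (\<lambda>y. G x y * (h x * g y)))"
    using sg_int_scale[of "-1"] by simp
  also have "\<dots> = - sg_int (\<lambda>y. sg_int (\<lambda>x. G x y * (h x * g y)))"
    using sg_int_swap[OF K] by simp
  also have "\<dots> = sg_int (\<lambda>y. -1 * sg_int (\<lambda>x. G x y * (h x * g y)))"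
    using sg_int_scale[of "-1"] by simp
  also have "\<dots> = sg_int (\<lambda>x. g x * T h x)"
  proof (rule sg_int_cong)
    fix y assume y: "y \<in> SG"
    have "sg_int (\<lambda>x. G x y * (h x * g y)) = sg_int (\<lambda>x. g y * (G y x * h x))"
      by (rule sg_int_cong) (use sym[OF _ y] in simp)
    then show "-1 * sg_int (\<lambda>x. G x y * (h x * g y)) = g y * T h y"
      by (simp add: sg_int_scale T_def)
  qed
  finally show ?thesis .
qed

text \<open>Both sides solve the Dirichlet problem for the reflected right-hand side, so parity
  follows from uniqueness rather than from a symmetry of \<open>G\<close> under the
  reflection.\<close>

lemma T_reflect:
  assumes g: "continuous_on SG g" "\<And>x. x \<in> SG \<Longrightarrow> g (sg_R x) = e * g x" and x: "x \<in> SG"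
  shows "T g (sg_R x) = e * T g x"
proof -
  note t = T_solves[OF g(1)]
  have "(T g \<circ> sg_R) x = e * T g x + 0 * T g x"
  proof (rule Dirichlet_unique[OF has_laplacian_R[OF t(1)] _ _ x])
    show "has_laplacian \<mu> (\<lambda>x. e * T g x + 0 * T g x) (g \<circ> sg_R)"
      using has_laplacian_linear[OF t(1) t(1), of e 0]
      by (rule has_laplacian_cong) (simp_all add: g(2))
  qed (simp add: t(2))
  then show ?thesis by simp
qed

end

section \<open>Orthogonal polynomials of one family\<close>

locale sg_family = sg_setting +
  fixes k :: nat
  assumes k: "k = 2 \<or> k = 3"
begin

abbreviation Q :: "nat \<Rightarrow> real^2 \<Rightarrow> real" where "Q j \<equiv> P j k"

lemma k_mem: "k \<in> {1,2,3}" using k by auto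

lemma has_laplacian_Q: "has_laplacian \<mu> (Q j) (case j of 0 \<Rightarrow> \<lambda>x. 0 | Suc i \<Rightarrow> Q i)"
  using has_laplacian_P0[OF k_mem] has_laplacian_P_Suc[OF k_mem] by (cases j) auto

lemma continuous_on_Q: "continuous_on SG (Q j)"
  by (rule has_laplacianD(2)[OF has_laplacian_Q])

definition lincomb :: "(nat \<Rightarrow> real) \<Rightarrow> nat \<Rightarrow> real^2 \<Rightarrow> real" where
  "lincomb c n x = (\<Sum>j<n. c j * Q j x)"

lemma continuous_on_lincomb: "continuous_on SG (lincomb c n)"
  unfolding lincomb_def by (intro continuous_intros continuous_on_Q)

lemma has_laplacian_sum:
  assumes "\<And>j. has_laplacian \<mu> (F j) (H j)"
  shows "has_laplacian \<mu> (\<lambda>x. \<Sum>j<(n::nat). c j * F j x) (\<lambda>x. \<Sum>j<n. c j * H j x)"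
proof (induction n)
  case 0
  then show ?case using has_laplacian_const[of 0] by simp
next
  case (Suc n)
  then show ?case using has_laplacian_linear[OF Suc assms[of n], of 1 "c n"] by simp
qed

lemma has_laplacian_lincomb_0: "has_laplacian \<mu> (lincomb c 0) (\<lambda>x. 0)"
  using has_laplacian_const[of 0] by (simp add: lincomb_def[abs_def])

lemma has_laplacian_lincomb: "has_laplacian \<mu> (lincomb c (Suc n)) (lincomb (c \<circ> Suc) n)"
proof -
  have "has_laplacian \<mu> (lincomb c (Suc n))
      (\<lambda>x. \<Sum>j<Suc n. c j * (case j of 0 \<Rightarrow> \<lambda>x. 0 | Suc i \<Rightarrow> Q i) x)"
    unfolding lincomb_def by (rule has_laplacian_sum[OF has_laplacian_Q])
  then show ?thesis
    by (rule has_laplacian_cong) (simp_all only: lincomb_def sum.lessThan_Suc_shift, simp)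
qed

lemma sg_int_lincomb:
  assumes g: "continuous_on SG g" and F: "\<And>j. continuous_on SG (F j)"
  shows "sg_int (\<lambda>x. g x * (\<Sum>j<(n::nat). c j * F j x)) = (\<Sum>j<n. c j * sg_int (\<lambda>x. g x * F j x))"
proof (induction n)
  case 0
  then show ?case by (simp add: sg_int_zero)
next
  case (Suc n)
  have "sg_int (\<lambda>x. g x * (\<Sum>j<Suc n. c j * F j x))
      = sg_int (\<lambda>x. 1 * (g x * (\<Sum>j<n. c j * F j x)) + c n * (g x * F n x))"
    by (simp add: algebra_simps)
  also have "\<dots> = 1 * sg_int (\<lambda>x. g x * (\<Sum>j<n. c j * F j x)) + c n * sg_int (\<lambda>x. g x * F n x)"
    by (intro sg_int_linear continuous_intros g F)
  finally show ?case using Suc by simp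
qed

subsection \<open>Polynomials\<close>

text \<open>The degree bound is strict: \<open>pol n\<close> admits \<open>Q 0\<close> up to
  \<open>Q (n - 1)\<close>, so \<open>pol 0\<close> leaves only the zero function on
  \<open>SG\<close>, while \<open>monic n\<close> has degree exactly \<open>n\<close>.\<close>

definition pol :: "nat \<Rightarrow> (real^2 \<Rightarrow> real) \<Rightarrow> bool" where
  "pol n u \<longleftrightarrow> (\<exists>c. \<forall>x\<in>SG. u x = lincomb c n x)"

definition monic :: "nat \<Rightarrow> (real^2 \<Rightarrow> real) \<Rightarrow> bool" where
  "monic n u \<longleftrightarrow> (\<exists>c. c n = 1 \<and> (\<forall>x\<in>SG. u x = lincomb c (Suc n) x))"

lemma monic_pol: "monic n u \<Longrightarrow> pol (Suc n) u"
  by (auto simp: monic_def pol_def)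

lemma pol_linear:
  assumes "pol n u" "pol n v" shows "pol n (\<lambda>x. a * u x + b * v x)"
proof -
  obtain c c' where "\<forall>x\<in>SG. u x = lincomb c n x" "\<forall>x\<in>SG. v x = lincomb c' n x"
    using assms unfolding pol_def by blast
  then have "\<forall>x\<in>SG. a * u x + b * v x = lincomb (\<lambda>j. a * c j + b * c' j) n x"
    by (simp add: lincomb_def sum_distrib_left sum.distrib algebra_simps)
  then show ?thesis unfolding pol_def by blast
qed

lemma pol_mono:
  assumes "pol m u" "m \<le> n" shows "pol n u"
proof -
  obtain c where c: "\<forall>x\<in>SG. u x = lincomb c m x" using assms unfolding pol_def by blast
  have "lincomb (\<lambda>j. if j < m then c j else 0) n x = lincomb c m x" for x
    unfolding lincomb_def using assms(2)
    by (intro sum.mono_neutral_cong_right) auto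
  then show ?thesis using c unfolding pol_def by metis
qed

lemma pol_continuous: "pol n u \<Longrightarrow> continuous_on SG u"
  unfolding pol_def using continuous_on_lincomb continuous_on_cong by metis

lemma monic_diff:
  assumes "monic n u" "monic n v" shows "pol n (\<lambda>x. 1 * u x + (-1) * v x)"
proof -
  obtain c c' where "c n = 1" "c' n = 1" "\<forall>x\<in>SG. u x = lincomb c (Suc n) x"
    "\<forall>x\<in>SG. v x = lincomb c' (Suc n) x"
    using assms unfolding monic_def by blast
  then have "\<forall>x\<in>SG. 1 * u x + (-1) * v x = lincomb (\<lambda>j. c j - c' j) n x"
    by (simp add: lincomb_def sum_subtractf algebra_simps)
  then show ?thesis unfolding pol_def by blast
qed

lemma monic_add:
  assumes "monic n u" "pol n v" shows "monic n (\<lambda>x. u x + b * v x)"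
proof -
  obtain c c' where c: "c n = 1" "\<forall>x\<in>SG. u x = lincomb c (Suc n) x" "\<forall>x\<in>SG. v x = lincomb c' n x"
    using assms unfolding monic_def pol_def by blast
  have "\<forall>x\<in>SG. u x + b * v x = lincomb (\<lambda>j. if j < n then c j + b * c' j else c j) (Suc n) x"
    using c by (simp add: lincomb_def sum_distrib_left sum.distrib algebra_simps)
  then show ?thesis using c(1) unfolding monic_def
    by (intro exI[of _ "\<lambda>j. if j < n then c j + b * c' j else c j"] conjI) simp_all
qed

lemma pol_Suc_decompose:
  assumes u: "pol (Suc n) u" and p: "monic n p"
  obtains a where "pol n (\<lambda>x. 1 * u x + (- a) * p x)"
proof -
  obtain c c' where c: "c' n = 1" "\<forall>x\<in>SG. u x = lincomb c (Suc n) x" "\<forall>x\<in>SG. p x = lincomb c' (Suc n) x"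
    using assms unfolding monic_def pol_def by blast
  then have "\<forall>x\<in>SG. 1 * u x + (- c n) * p x = lincomb (\<lambda>j. c j - c n * c' j) n x"
    by (simp add: lincomb_def sum_subtractf sum_distrib_left algebra_simps sum_negf)
  then have "pol n (\<lambda>x. 1 * u x + (- c n) * p x)" unfolding pol_def by blast
  then show ?thesis by (rule that)
qed

lemma pol_laplacian: "pol n u \<Longrightarrow> has_laplacian \<mu> u (L u)"
  unfolding pol_def
  using has_laplacian_lincomb has_laplacian_lincomb_0 has_laplacian_cong has_laplacian_L
  by (metis (no_types, lifting) not0_implies_Suc)

lemma pol_L: "pol (Suc n) u \<Longrightarrow> pol n (L u)"
proof -
  assume u: "pol (Suc n) u"
  then obtain c where "\<forall>x\<in>SG. u x = lincomb c (Suc n) x" unfolding pol_def by blast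
  then have "has_laplacian \<mu> u (lincomb (c \<circ> Suc) n)"
    by (intro has_laplacian_cong[OF has_laplacian_lincomb]) simp_all
  then show ?thesis unfolding pol_def using L_eq by blast
qed

lemma monic_L: "monic (Suc n) u \<Longrightarrow> monic n (L u)"
proof -
  assume "monic (Suc n) u"
  then obtain c where c: "c (Suc n) = 1" "\<forall>x\<in>SG. u x = lincomb c (Suc (Suc n)) x"
    unfolding monic_def by blast
  then have "has_laplacian \<mu> u (lincomb (c \<circ> Suc) (Suc n))"
    by (intro has_laplacian_cong[OF has_laplacian_lincomb]) simp_all
  then show ?thesis unfolding monic_def using L_eq c(1) by (intro exI[of _ "c \<circ> Suc"]) simp
qed

lemma pol_L': "pol n u \<Longrightarrow> pol (n - 1) (L u)"
proof (cases n)
  case 0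
  assume "pol n u"
  then have "pol (Suc 0) u" by (rule pol_mono) (simp add: 0)
  then show ?thesis using pol_L 0 by simp
qed (simp add: pol_L)

lemma L_linear:
  assumes "has_laplacian \<mu> u (L u)" "has_laplacian \<mu> v (L v)" "x \<in> SG"
  shows "L (\<lambda>x. a * u x + b * v x) x = a * L u x + b * L v x"
  using L_eq[OF has_laplacian_linear[OF assms(1,2)] assms(3)] .

lemma L_cong:
  assumes "has_laplacian \<mu> u f" "\<And>x. x \<in> SG \<Longrightarrow> u x = v x" "x \<in> SG"
  shows "L v x = L u x"
  using L_eq[OF has_laplacian_cong[OF has_laplacian_L[OF assms(1)] assms(2)] assms(3)] by simp

text \<open>Linear independence of the family. The Laplacian lowers the degree by one and keeps the
  leading coefficient, so a vanishing monic polynomial would force \<open>Q 0\<close> to vanish,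
  against its nonzero derivative at \<open>sg_q 0\<close>.\<close>

lemma monic_nonzero: "monic n u \<Longrightarrow> \<exists>x\<in>SG. u x \<noteq> 0"
proof (induction n arbitrary: u)
  case 0
  then obtain c where "c 0 = 1" "\<forall>x\<in>SG. u x = lincomb c (Suc 0) x" unfolding monic_def by blast
  then have u: "\<forall>x\<in>SG. u x = Q 0 x" by (simp add: lincomb_def)
  show ?case
  proof (rule ccontr)
    assume "\<not> ?thesis"
    then have "harm 0 (of_bool (k = 2)) (of_bool (k = 3)) x = 0" if "x \<in> SG" for x
      using u that k by (auto simp: harm_def)
    from harm_eq_0(2,3)[OF this] show False using k by auto
  qed
next
  case (Suc n)
  show ?case
  proof (rule ccontr)
    assume "\<not> ?thesis"
    then have u: "0 = u x" if "x \<in> SG" for x using that by simp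
    have "L u x = 0" if "x \<in> SG" for x
      using L_eq[OF has_laplacian_cong[OF has_laplacian_const[of 0] u refl] that] .
    then show False using Suc.IH[OF monic_L[OF Suc.prems]] by blast
  qed
qed

lemma lincomb_reflect: "x \<in> SG \<Longrightarrow> lincomb c n (sg_R x) = (if k = 2 then 1 else -1) * lincomb c n x"
  unfolding lincomb_def using P_reflect[OF k] by (simp add: sum_distrib_left sum_negf)

text \<open>The harmonic correction \<open>T g - u\<close> vanishes at \<open>q\<^sub>0\<close> and has the parity of the family,
  which leaves only a multiple of \<open>Q 0\<close>.\<close>

lemma T_lincomb:
  obtains a where "\<And>x. x \<in> SG \<Longrightarrow> T (lincomb c n) x = lincomb (case_nat a c) (Suc n) x"
proof -
  let ?g = "lincomb c n" and ?e = "if k = 2 then 1 else -1 :: real"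
  \<comment> \<open>Shifting the coefficients up by one gives the antiderivative without a
    \<open>Q 0\<close> term.\<close>
  define u where "u = lincomb (case_nat 0 c) (Suc n)"
  have cg: "continuous_on SG ?g" by (rule continuous_on_lincomb)
  have shift: "case_nat 0 c \<circ> Suc = c" by (simp add: fun_eq_iff)
  have "has_laplacian \<mu> u ?g"
    using has_laplacian_lincomb[of "case_nat 0 c" n] unfolding u_def shift .
  from has_laplacian_linear[OF T_solves(1)[OF cg] this, of 1 "-1"]
  have "has_laplacian \<mu> (\<lambda>x. 1 * T ?g x + (-1) * u x) (\<lambda>x. 0)" by simp
  then obtain \<alpha> \<beta> \<gamma> where h: "\<And>x. x \<in> SG \<Longrightarrow> 1 * T ?g x + (-1) * u x = harm \<alpha> \<beta> \<gamma> x"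
    by (rule harmonic_eq_harm) (rule that)
  have "Q j (sg_q 0) = 0" for j using P_jet(1)[OF k_mem, of j] k by auto
  then have "u (sg_q 0) = 0" by (simp add: u_def lincomb_def)
  moreover have "T ?g (sg_q 0) = 0" by (rule T_solves(2)[OF cg]) (simp add: sg_V0_def)
  ultimately have \<alpha>: "\<alpha> = 0"
    using h[OF sg_F0_pow_q_in_SG(3)] harm_jet(1)[of \<alpha> \<beta> \<gamma>] by simp
  have refl: "harm \<alpha> \<beta> \<gamma> (sg_R x) = ?e * harm \<alpha> \<beta> \<gamma> x" if x: "x \<in> SG" for x
    using h[OF x] h[of "sg_R x"] x T_reflect[OF cg lincomb_reflect x] lincomb_reflect[OF x]
    unfolding u_def by (simp add: algebra_simps)
  \<comment> \<open>The coefficients select the component of the wrong parity: the tangential one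
    for \<open>k = 2\<close>, the normal one for \<open>k = 3\<close>. Parity makes it equal to its
    own negative.\<close>
  have "harm 0 (of_bool (k = 3) * \<beta>) (of_bool (k = 2) * \<gamma>) x = 0" if x: "x \<in> SG" for x
    using refl[OF x] P_reflect[of 2 x 0] P_reflect[of 3 x 0] x k \<alpha> by (auto simp: harm_def)
  from harm_eq_0(2,3)[OF this] have "harm \<alpha> \<beta> \<gamma> x = (if k = 2 then \<beta> else \<gamma>) * Q 0 x" for x
    using k \<alpha> by (auto simp: harm_def)
  moreover have "lincomb (case_nat a c) (Suc n) x = u x + a * Q 0 x" for a x
    by (simp add: u_def lincomb_def sum.lessThan_Suc_shift del: sum.lessThan_Suc)
  ultimately have "T ?g x = lincomb (case_nat (if k = 2 then \<beta> else \<gamma>) c) (Suc n) x" if "x \<in> SG" for x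
    using h[OF that] by simp
  then show ?thesis by (rule that)
qed

lemma pol_T: assumes "pol n g" shows "pol (Suc n) (T g)"
proof -
  obtain c where c: "\<And>x. x \<in> SG \<Longrightarrow> g x = lincomb c n x" using assms unfolding pol_def by blast
  obtain a where "\<And>x. x \<in> SG \<Longrightarrow> T (lincomb c n) x = lincomb (case_nat a c) (Suc n) x"
    using T_lincomb[of c n] by metis
  then show ?thesis unfolding pol_def using T_cong[of g "lincomb c n"] c by metis
qed

lemma monic_T: assumes "monic n g" shows "monic (Suc n) (T g)"
proof -
  obtain c where c: "c n = 1" "\<And>x. x \<in> SG \<Longrightarrow> g x = lincomb c (Suc n) x"
    using assms unfolding monic_def by blast
  obtain a where "\<And>x. x \<in> SG \<Longrightarrow> T (lincomb c (Suc n)) x = lincomb (case_nat a c) (Suc (Suc n)) x"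
    using T_lincomb[of c "Suc n"] by metis
  then show ?thesis unfolding monic_def using T_cong[of g "lincomb c (Suc n)"] c
    by (intro exI[of _ "case_nat a c"]) simp
qed

lemma L_T: "continuous_on SG g \<Longrightarrow> x \<in> SG \<Longrightarrow> L (T g) x = g x"
  by (rule L_eq[OF T_solves(1)])

subsection \<open>Inner products\<close>

lemma l2_inner_eq: "l2_inner \<mu> f g = sg_int (\<lambda>x. f x * g x)"
  by (simp add: l2_inner_def sg_int_def)

lemma sob_inner_eq: "sob_inner \<mu> chi f g = sg_int (\<lambda>x. f x * g x) + chi * sg_int (\<lambda>x. L f x * L g x)"
  by (simp add: sob_inner_def sg_int_def)

lemma l2_inner_commute: "l2_inner \<mu> f g = l2_inner \<mu> g f"
  by (simp add: l2_inner_eq mult.commute)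

lemma sob_inner_commute: "sob_inner \<mu> chi f g = sob_inner \<mu> chi g f"
  by (simp add: sob_inner_eq mult.commute)

lemma l2_inner_cong:
  "(\<And>x. x \<in> SG \<Longrightarrow> f x = f' x) \<Longrightarrow> (\<And>x. x \<in> SG \<Longrightarrow> g x = g' x) \<Longrightarrow>
    l2_inner \<mu> f g = l2_inner \<mu> f' g'"
  unfolding l2_inner_eq by (rule sg_int_cong) simp

lemma l2_inner_linear:
  assumes "continuous_on SG f" "continuous_on SG u" "continuous_on SG v"
  shows "l2_inner \<mu> f (\<lambda>x. a * u x + b * v x) = a * l2_inner \<mu> f u + b * l2_inner \<mu> f v"
proof -
  have "l2_inner \<mu> f (\<lambda>x. a * u x + b * v x) = sg_int (\<lambda>x. a * (f x * u x) + b * (f x * v x))"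
    by (simp add: l2_inner_eq algebra_simps)
  also have "\<dots> = a * l2_inner \<mu> f u + b * l2_inner \<mu> f v"
    unfolding l2_inner_eq by (intro sg_int_linear continuous_intros assms)
  finally show ?thesis .
qed

lemma l2_inner_pos:
  assumes "continuous_on SG u" "x \<in> SG" "u x \<noteq> 0" shows "0 < l2_inner \<mu> u u"
  unfolding l2_inner_eq using assms by (intro sg_int_pos[of _ x] continuous_intros) auto

lemma l2_inner_nonneg: "continuous_on SG u \<Longrightarrow> 0 \<le> l2_inner \<mu> u u"
  unfolding l2_inner_eq sg_int_def set_lebesgue_integral_def
  by (intro Bochner_Integration.integral_nonneg) simp

lemma l2_inner_monic_pos: "monic n u \<Longrightarrow> 0 < l2_inner \<mu> u u"
  using monic_nonzero l2_inner_pos pol_continuous monic_pol by metis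

lemma l2_norm_sq: "continuous_on SG u \<Longrightarrow> (l2_norm \<mu> u)^2 = l2_inner \<mu> u u"
  unfolding l2_norm_def using l2_inner_nonneg by simp

lemma sob_inner_l2: "sob_inner \<mu> chi f g = l2_inner \<mu> f g + chi * l2_inner \<mu> (L f) (L g)"
  by (simp add: sob_inner_eq l2_inner_eq)

text \<open>The \<open>pol\<close> hypotheses guarantee that the Laplacians exist, so that agreement
  on \<open>SG\<close> passes to the values of the definite description.\<close>

lemma sob_inner_cong:
  assumes "pol n f" "pol m g" "\<And>x. x \<in> SG \<Longrightarrow> f x = f' x" "\<And>x. x \<in> SG \<Longrightarrow> g x = g' x"
  shows "sob_inner \<mu> chi f g = sob_inner \<mu> chi f' g'"
proof -
  have "l2_inner \<mu> (L f) (L g) = l2_inner \<mu> (L f') (L g')"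
    using L_cong[OF pol_laplacian[OF assms(1)] assms(3)] L_cong[OF pol_laplacian[OF assms(2)] assms(4)]
    by (intro l2_inner_cong) simp_all
  moreover have "l2_inner \<mu> f g = l2_inner \<mu> f' g'" using assms(3,4) by (rule l2_inner_cong)
  ultimately show ?thesis by (simp add: sob_inner_l2)
qed

lemma sob_inner_linear:
  assumes f: "pol l f" and u: "pol m u" and v: "pol n v"
  shows "sob_inner \<mu> chi f (\<lambda>x. a * u x + b * v x) = a * sob_inner \<mu> chi f u + b * sob_inner \<mu> chi f v"
proof -
  have "l2_inner \<mu> (L f) (L (\<lambda>x. a * u x + b * v x)) = l2_inner \<mu> (L f) (\<lambda>x. a * L u x + b * L v x)"
    using L_linear[OF pol_laplacian[OF u] pol_laplacian[OF v]] by (intro l2_inner_cong) simp_all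
  then show ?thesis
    using l2_inner_linear[OF pol_continuous[OF f] pol_continuous[OF u] pol_continuous[OF v], of a b]
      l2_inner_linear[OF pol_continuous[OF pol_L'[OF f]] pol_continuous[OF pol_L'[OF u]]
        pol_continuous[OF pol_L'[OF v]], of a b]
    by (simp add: sob_inner_l2 algebra_simps)
qed

lemma sob_inner_monic_pos: "monic n u \<Longrightarrow> 0 \<le> chi \<Longrightarrow> 0 < sob_inner \<mu> chi u u"
  unfolding sob_inner_l2
  using l2_inner_monic_pos l2_inner_nonneg[OF pol_continuous[OF pol_L'[OF monic_pol]]]
  by (intro add_pos_nonneg mult_nonneg_nonneg) blast+

lemma sob_norm_sq: "monic n u \<Longrightarrow> 0 \<le> chi \<Longrightarrow> (sob_norm \<mu> chi u)^2 = sob_inner \<mu> chi u u"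
  unfolding sob_norm_def using sob_inner_monic_pos[of n u chi] by simp

section \<open>Orthogonality and three-term expansions\<close>

lemma is_monic_orthogonal_monic:
  assumes "is_monic_orthogonal ip Q p" shows "monic n (p n)"
proof -
  obtain c where c: "\<forall>x\<in>SG. p n x = Q n x + (\<Sum>j<n. c j * Q j x)"
    using assms unfolding is_monic_orthogonal_def by blast
  have "\<forall>x\<in>SG. p n x = lincomb (c(n := 1)) (Suc n) x" using c by (simp add: lincomb_def)
  then show ?thesis unfolding monic_def by (intro exI[of _ "c(n := 1)"]) simp
qed

lemma l2_orthogonal_pol:
  assumes p: "is_monic_orthogonal (l2_inner \<mu>) Q p" and u: "pol n u"
  shows "l2_inner \<mu> (p n) u = 0"
proof -
  obtain c where c: "\<And>x. x \<in> SG \<Longrightarrow> u x = lincomb c n x" using u unfolding pol_def by blast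
  have "l2_inner \<mu> (p n) u = l2_inner \<mu> (p n) (lincomb c n)" by (rule l2_inner_cong) (simp_all add: c)
  also have "\<dots> = (\<Sum>j<n. c j * l2_inner \<mu> (p n) (Q j))"
    unfolding l2_inner_eq lincomb_def
    by (intro sg_int_lincomb continuous_on_Q pol_continuous[OF monic_pol[OF is_monic_orthogonal_monic[OF p]]])
  also have "\<dots> = 0" using p unfolding is_monic_orthogonal_def by (intro sum.neutral) simp
  finally show ?thesis .
qed

lemma pol_Q: "pol (Suc n) (Q n)"
  unfolding pol_def by (intro exI[of _ "\<lambda>j. of_bool (j = n)"]) (simp add: lincomb_def)

lemma sob_orthogonal_pol:
  assumes s: "is_monic_orthogonal (sob_inner \<mu> chi) Q s" and u: "pol m u" "m \<le> n"
  shows "sob_inner \<mu> chi (s n) u = 0"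
  using u
proof (induction m arbitrary: u)
  case 0
  \<comment> \<open>Here \<open>u\<close> vanishes on \<open>SG\<close>; writing it as a trivial
    linear combination lets bilinearity produce the value 0.\<close>
  have "sob_inner \<mu> chi (s n) u = sob_inner \<mu> chi (s n) (\<lambda>x. 0 * u x + 0 * u x)"
    by (rule sob_inner_cong[OF monic_pol[OF is_monic_orthogonal_monic[OF s]] 0(1)])
      (use 0(1) in \<open>auto simp: pol_def lincomb_def\<close>)
  also have "\<dots> = 0"
    by (subst sob_inner_linear[OF monic_pol[OF is_monic_orthogonal_monic[OF s]] 0(1) 0(1)]) simp
  finally show ?case .
next
  case (Suc m)
  note sn = monic_pol[OF is_monic_orthogonal_monic[OF s, of n]]
  have "monic m (Q m)"
    unfolding monic_def by (intro exI[of _ "\<lambda>j. of_bool (j = m)"]) (simp add: lincomb_def)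
  then obtain a where a: "pol m (\<lambda>x. 1 * u x + (- a) * Q m x)"
    using pol_Suc_decompose[OF Suc.prems(1)] by blast
  have "sob_inner \<mu> chi (s n) (Q m) = 0"
    using s Suc.prems(2) unfolding is_monic_orthogonal_def by simp
  moreover have "sob_inner \<mu> chi (s n) (\<lambda>x. 1 * u x + (- a) * Q m x) = 0"
    using Suc.IH[OF a] Suc.prems(2) by simp
  ultimately show ?case
    unfolding sob_inner_linear[OF sn Suc.prems(1) pol_Q] by simp
qed

text \<open>The polynomials \<open>p 0\<close> up to \<open>p (n - 1)\<close> span everything of
  degree below \<open>n\<close>, by removing leading terms. Thus \<open>u\<close> is orthogonal to
  itself.\<close>

lemma pol_eq_0:
  assumes p: "is_monic_orthogonal (l2_inner \<mu>) Q p" and u: "pol n u"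
    and orth: "\<And>m. m < n \<Longrightarrow> l2_inner \<mu> (p m) u = 0" and x: "x \<in> SG"
  shows "u x = 0"
proof (rule ccontr)
  note cont = pol_continuous[OF u]
  have "l2_inner \<mu> v u = 0" if "pol m v" "m \<le> n" for m v
    using that
  proof (induction m arbitrary: v)
    case 0
    then have "l2_inner \<mu> v u = l2_inner \<mu> (\<lambda>x. 0) u"
      by (intro l2_inner_cong) (auto simp: pol_def lincomb_def)
    then show ?case by (simp add: l2_inner_eq sg_int_zero)
  next
    case (Suc m)
    note pm = is_monic_orthogonal_monic[OF p, of m]
    obtain a where a: "pol m (\<lambda>x. 1 * v x + (- a) * p m x)"
      using pol_Suc_decompose[OF Suc.prems(1) pm] by blast
    have "l2_inner \<mu> u (\<lambda>x. 1 * v x + (- a) * p m x) = 0"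
      using Suc.IH[OF a] Suc.prems(2) l2_inner_commute by simp
    moreover have "l2_inner \<mu> u (p m) = 0"
      using orth[of m] Suc.prems(2) l2_inner_commute by simp
    ultimately show ?case
      unfolding l2_inner_linear[OF cont pol_continuous[OF Suc.prems(1)] pol_continuous[OF monic_pol[OF pm]]]
      using l2_inner_commute[of v u] by simp
  qed
  from this[OF u order_refl] have "l2_inner \<mu> u u = 0" .
  moreover assume "u x \<noteq> 0"
  ultimately show False using l2_inner_pos[OF cont x] by simp
qed

text \<open>Subtracting \<open>p (Suc n)\<close> and the two Fourier terms leaves a remainder of
  degree at most \<open>n\<close> that is orthogonal to \<open>p 0\<close> up to \<open>p n\<close>,
  hence zero.\<close>

lemma three_term_expansion:
  assumes p: "is_monic_orthogonal (l2_inner \<mu>) Q p" and u: "monic (Suc n) u"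
    and orth: "\<And>m. Suc m < n \<Longrightarrow> l2_inner \<mu> (p m) u = 0" and x: "x \<in> SG"
  shows "u x = p (Suc n) x + l2_inner \<mu> (p n) u / l2_inner \<mu> (p n) (p n) * p n x
    + (if n = 0 then 0 else
        l2_inner \<mu> (p (n - 1)) u / l2_inner \<mu> (p (n - 1)) (p (n - 1)) * p (n - 1) x)"
proof -
  define C where "C m = l2_inner \<mu> (p m) u / l2_inner \<mu> (p m) (p m)" for m
  \<comment> \<open>For \<open>n = 0\<close> truncated subtraction makes \<open>n - 1\<close> equal
    to \<open>n\<close>; the zero coefficient prevents \<open>p 0\<close> from being counted
    twice.\<close>
  define B where "B = (if n = 0 then 0 else C (n - 1))"
  note pm = is_monic_orthogonal_monic[OF p]
  note cp = pol_continuous[OF monic_pol[OF pm]] and cu = pol_continuous[OF monic_pol[OF u]]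
  define v where "v = (\<lambda>x. 1 * u x + (-1) * p (Suc n) x)"
  define t where "t = (\<lambda>x. C n * p n x + B * p (n - 1) x)"
  define w where "w = (\<lambda>x. 1 * v x + (-1) * t x)"
  have v: "pol (Suc n) v" unfolding v_def by (rule monic_diff[OF u pm])
  have t: "pol (Suc n) t"
    unfolding t_def by (intro pol_linear monic_pol pm pol_mono[OF monic_pol[OF pm, of "n - 1"]]) simp
  have w: "pol (Suc n) w" unfolding w_def by (rule pol_linear[OF v t])
  have orth_p: "l2_inner \<mu> (p m) (p m') = 0" if "m \<noteq> m'" for m m'
    using l2_orthogonal_pol[OF p pol_mono[OF monic_pol[OF pm]], of m' m]
      l2_orthogonal_pol[OF p pol_mono[OF monic_pol[OF pm]], of m m'] l2_inner_commute that
    by (cases "m < m'") auto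
  have C: "C m * l2_inner \<mu> (p m) (p m) = l2_inner \<mu> (p m) u" for m
    using l2_inner_monic_pos[OF pm, of m] by (simp add: C_def)
  have "l2_inner \<mu> (p m) w = 0" if m: "m < Suc n" for m
  proof -
    have "l2_inner \<mu> (p m) w = l2_inner \<mu> (p m) u - l2_inner \<mu> (p m) (p (Suc n))
        - (C n * l2_inner \<mu> (p m) (p n) + B * l2_inner \<mu> (p m) (p (n - 1)))"
      unfolding w_def l2_inner_linear[OF cp pol_continuous[OF v] pol_continuous[OF t]]
      unfolding v_def l2_inner_linear[OF cp cu cp]
      unfolding t_def l2_inner_linear[OF cp cp cp] by simp
    also have "l2_inner \<mu> (p m) (p (Suc n)) = 0" using m by (intro orth_p) simp
    finally have eq: "l2_inner \<mu> (p m) w = l2_inner \<mu> (p m) u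
        - (C n * l2_inner \<mu> (p m) (p n) + B * l2_inner \<mu> (p m) (p (n - 1)))" by simp
    consider "m = n" | "Suc m = n" | "Suc m < n" using m by linarith
    then show ?thesis
    proof cases
      case 1
      then show ?thesis using eq C[of n] orth_p[of n "n - 1"] by (cases n) (simp_all add: B_def)
    next
      case 2
      then show ?thesis using eq C[of m] orth_p[of m n] by (auto simp: B_def)
    next
      case 3
      then show ?thesis using eq orth[OF 3] orth_p[of m n] orth_p[of m "n - 1"] by simp
    qed
  qed
  then have "w x = 0" by (rule pol_eq_0[OF p w _ x])
  then show ?thesis by (simp add: w_def v_def t_def B_def C_def split: if_splits)
qed

lemma three_term_L:
  assumes "is_monic_orthogonal (l2_inner \<mu>) Q p" "pol N u" "x \<in> SG"
    and eq: "\<And>x. x \<in> SG \<Longrightarrow> u x = p (Suc n) x + a * p n x + (if n = 0 then 0 else b * p (n - 1) x)"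
  shows "L u x = L (p (Suc n)) x + a * L (p n) x + (if n = 0 then 0 else b * L (p (n - 1)) x)"
proof -
  define b' where "b' = (if n = 0 then 0 else b)"
  note pp = monic_pol[OF is_monic_orthogonal_monic[OF assms(1)]]
  note l = pol_laplacian[OF pp]
  let ?w = "\<lambda>x. 1 * (1 * p (Suc n) x + a * p n x) + b' * p (n - 1) x"
  note w = has_laplacian_linear[OF has_laplacian_linear[OF l[of "Suc n"] l[of n], of 1 a] l[of "n - 1"], of 1 b']
  have "L u x = L ?w x"
    by (rule L_cong[OF w _ assms(3)]) (simp add: eq b'_def)
  also have "\<dots> = 1 * (1 * L (p (Suc n)) x + a * L (p n) x) + b' * L (p (n - 1)) x"
    by (rule L_eq[OF w assms(3)])
  finally show ?thesis by (simp add: b'_def)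
qed

text \<open>\<open>T v + chi \<Delta>v\<close> represents the Sobolev product with \<open>v\<close> in the \<open>L\<^sup>2\<close> product, because
  \<open>T\<close> is symmetric and inverts the Laplacian.\<close>

lemma l2_inner_T_add_L:
  assumes g: "pol m g" and v: "pol n v"
  shows "l2_inner \<mu> g (\<lambda>x. T v x + chi * L v x) = sob_inner \<mu> chi v (T g)"
proof -
  note cont = pol_continuous[OF g] pol_continuous[OF v] pol_continuous[OF pol_L'[OF v]]
  have "l2_inner \<mu> g (\<lambda>x. 1 * T v x + chi * L v x) = 1 * l2_inner \<mu> g (T v) + chi * l2_inner \<mu> g (L v)"
    by (intro l2_inner_linear cont continuous_on_T)
  moreover have "l2_inner \<mu> g (T v) = l2_inner \<mu> v (T g)"
    using T_symmetric[OF cont(1,2)] l2_inner_commute[of v "T g"] by (simp add: l2_inner_eq)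
  moreover have "l2_inner \<mu> g (L v) = l2_inner \<mu> (L v) (L (T g))"
    unfolding l2_inner_commute[of g] using L_T[OF cont(1)] by (intro l2_inner_cong) simp_all
  ultimately show ?thesis by (simp add: sob_inner_l2)
qed

lemma sobolev_recurrence:
  assumes p: "is_monic_orthogonal (l2_inner \<mu>) Q p" and s: "is_monic_orthogonal (sob_inner \<mu> chi) Q s"
    and x: "x \<in> SG"
  shows "s n x + chi * L (L (s n)) x = L (p (Suc n)) x
    + sob_inner \<mu> chi (s n) (T (p n)) / l2_inner \<mu> (p n) (p n) * L (p n) x
    + (if n = 0 then 0 else
        sob_inner \<mu> chi (s n) (s n) / l2_inner \<mu> (p (n - 1)) (p (n - 1)) * L (p (n - 1)) x)"
proof -
  note pm = is_monic_orthogonal_monic[OF p] and sm = is_monic_orthogonal_monic[OF s]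
  define U where "U = (\<lambda>x. T (s n) x + chi * L (s n) x)"
  \<comment> \<open>The degree of this summand is below \<open>n + 1\<close>, so it does not affect
    the leading coefficient of \<open>U\<close>.\<close>
  have "pol (Suc n) (L (s n))"
    using pol_mono[OF pol_L[OF monic_pol[OF sm]], of n] by simp
  then have U: "monic (Suc n) U" unfolding U_def by (intro monic_add monic_T sm)
  have inner: "l2_inner \<mu> (p m) U = sob_inner \<mu> chi (s n) (T (p m))" for m
    unfolding U_def by (rule l2_inner_T_add_L[OF monic_pol[OF pm] monic_pol[OF sm]])
  \<comment> \<open>Both \<open>T (p (n - 1))\<close> and \<open>s n\<close> are monic of degree
    \<open>n\<close>, so their difference is Sobolev-orthogonal to \<open>s n\<close>. This is the
    origin of the squared norm of \<open>s n\<close> in the last coefficient.\<close>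
  have prev: "l2_inner \<mu> (p (n - 1)) U = sob_inner \<mu> chi (s n) (s n)" if "n \<noteq> 0"
  proof -
    have t: "monic n (T (p (n - 1)))" using monic_T[OF pm[of "n - 1"]] that by simp
    have "sob_inner \<mu> chi (s n) (\<lambda>x. 1 * T (p (n - 1)) x + (-1) * s n x) = 0"
      by (rule sob_orthogonal_pol[OF s monic_diff[OF t sm] order_refl])
    then show ?thesis
      unfolding inner sob_inner_linear[OF monic_pol[OF sm] monic_pol[OF t] monic_pol[OF sm]] by simp
  qed
  have far: "l2_inner \<mu> (p m) U = 0" if "Suc m < n" for m
    unfolding inner using sob_orthogonal_pol[OF s pol_T[OF monic_pol[OF pm]]] that by simp
  have exp: "U y = p (Suc n) y + sob_inner \<mu> chi (s n) (T (p n)) / l2_inner \<mu> (p n) (p n) * p n y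
    + (if n = 0 then 0 else
        sob_inner \<mu> chi (s n) (s n) / l2_inner \<mu> (p (n - 1)) (p (n - 1)) * p (n - 1) y)"
    if "y \<in> SG" for y
    using three_term_expansion[OF p U far that] prev inner[of n] by simp
  have cs: "continuous_on SG (s n)" by (rule pol_continuous[OF monic_pol[OF sm]])
  have "has_laplacian \<mu> (\<lambda>x. 1 * T (s n) x + chi * L (s n) x) (\<lambda>x. 1 * s n x + chi * L (L (s n)) x)"
    by (intro has_laplacian_linear T_solves(1) cs pol_laplacian[OF pol_L'[OF monic_pol[OF sm]]])
  then have "L U x = s n x + chi * L (L (s n)) x"
    using L_eq[OF _ x] by (fastforce simp: U_def)
  then show ?thesis using three_term_L[OF p monic_pol[OF U] x exp] by simp
qed

text \<open>Symmetry moves \<open>T\<close> from \<open>p n\<close> onto \<open>p m\<close>, which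
  raises the degree to \<open>m + 1\<close> only; orthogonality of \<open>p n\<close> then removes
  all terms but three.\<close>

lemma legendre_recurrence:
  assumes p: "is_monic_orthogonal (l2_inner \<mu>) Q p" and x: "x \<in> SG"
  shows "p n x = L (p (Suc n)) x + l2_inner \<mu> (T (p n)) (p n) / l2_inner \<mu> (p n) (p n) * L (p n) x
    + (if n = 0 then 0 else l2_inner \<mu> (T (p n)) (p (n - 1)) / l2_inner \<mu> (p (n - 1)) (p (n - 1))
        * L (p (n - 1)) x)"
proof -
  note pm = is_monic_orthogonal_monic[OF p]
  note cp = pol_continuous[OF monic_pol[OF pm]]
  have far: "l2_inner \<mu> (p m) (T (p n)) = 0" if "Suc m < n" for m
  proof -
    have "l2_inner \<mu> (p m) (T (p n)) = l2_inner \<mu> (p n) (T (p m))"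
      using T_symmetric[OF cp[of m] cp[of n]] l2_inner_commute[of "p n" "T (p m)"]
      by (simp add: l2_inner_eq)
    also have "\<dots> = 0"
      using that by (intro l2_orthogonal_pol[OF p] pol_mono[OF pol_T[OF monic_pol[OF pm]]]) simp
    finally show ?thesis .
  qed
  have exp: "T (p n) y = p (Suc n) y + l2_inner \<mu> (T (p n)) (p n) / l2_inner \<mu> (p n) (p n) * p n y
    + (if n = 0 then 0 else l2_inner \<mu> (T (p n)) (p (n - 1)) / l2_inner \<mu> (p (n - 1)) (p (n - 1))
        * p (n - 1) y)" if "y \<in> SG" for y
    using three_term_expansion[OF p monic_T[OF pm] far that] by (simp add: l2_inner_commute[of "T (p n)"])
  show ?thesis
    using three_term_L[OF p monic_pol[OF monic_T[OF pm]] x exp] L_T[OF cp x] by simp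
qed

end

theorem theorem3p3:
  fixes \<mu> :: "(real^2) measure"
    and G :: "real^2 \<Rightarrow> real^2 \<Rightarrow> real"
    and P :: "nat \<Rightarrow> nat \<Rightarrow> real^2 \<Rightarrow> real"
    and k :: nat and chi :: real
    and p s f :: "nat \<Rightarrow> real^2 \<Rightarrow> real"
    and d \<xi> a b c :: "nat \<Rightarrow> real"
    and n :: nat
  assumes "is_sg_measure \<mu>"
    and "is_green \<mu> G"
    and "\<And>j i. i \<in> {1,2,3} \<Longrightarrow> is_monomial \<mu> j i (P j i)"
    and "k = 2 \<or> k = 3"
    and "chi > 0"
    and "is_monic_orthogonal (l2_inner \<mu>) (\<lambda>j. P j k) p"
    and "is_monic_orthogonal (sob_inner \<mu> chi) (\<lambda>j. P j k) s"
    and "\<And>m. d m powi (-2) = (l2_norm \<mu> (p m))^2"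
    and "\<And>m. \<xi> m powi (-2) = (sob_norm \<mu> chi (s m))^2"
    and "\<And>m x. x \<in> SG \<Longrightarrow> f (m + 1) x = - (LINT y:SG|\<mu>. G x y * p m y)"
    and "\<And>m. a m = sob_inner \<mu> chi (f (m + 1)) (s m) / (sob_norm \<mu> chi (s m))^2"
    and "\<And>m. b m = l2_inner \<mu> (f (m + 1)) (p m) / (l2_norm \<mu> (p m))^2"
    and "\<And>m. m \<ge> 1 \<Longrightarrow>
           c m = l2_inner \<mu> (f (m + 1)) (p (m - 1)) / (l2_norm \<mu> (p (m - 1)))^2"
  shows "\<forall>x\<in>SG.
      s n x + chi * (laplacian \<mu> ^^ 2) (s n) x
        = laplacian \<mu> (p (n + 1)) x
          + a n * (d n)^2 * \<xi> n powi (-2) * laplacian \<mu> (p n) x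
          + (if n = 0 then 0
             else (d (n - 1))^2 * \<xi> n powi (-2) * laplacian \<mu> (p (n - 1)) x)
    \<and> s n x + chi * (laplacian \<mu> ^^ 2) (s n) x
        = p n x
          + (a n * (d n)^2 * \<xi> n powi (-2) - b n) * laplacian \<mu> (p n) x
          + (if n = 0 then 0
             else ((d (n - 1))^2 * \<xi> n powi (-2) - c n) * laplacian \<mu> (p (n - 1)) x)"
proof
  fix x assume x: "x \<in> SG"
  interpret sg_family \<mu> G P k
    using assms(1-4) by unfold_locales
  note p = assms(6) and s = assms(7)
  note pm = is_monic_orthogonal_monic[OF p] and sm = is_monic_orthogonal_monic[OF s]
  have f: "T (p m) y = f (Suc m) y" if "y \<in> SG" for m y
    using assms(10)[OF that, of m] by (simp add: T_def sg_int_def)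
  have norm_p: "(l2_norm \<mu> (p m))^2 = l2_inner \<mu> (p m) (p m)" for m
    by (rule l2_norm_sq[OF pol_continuous[OF monic_pol[OF pm]]])
  have norm_s: "(sob_norm \<mu> chi (s m))^2 = sob_inner \<mu> chi (s m) (s m)" for m
    using sob_norm_sq[OF sm] assms(5) by simp
  have d: "(d m)^2 = 1 / l2_inner \<mu> (p m) (p m)" for m
  proof -
    have "l2_inner \<mu> (p m) (p m) = inverse ((d m)^2)"
      using assms(8)[of m] norm_p[of m] by (simp add: power_int_minus)
    then show ?thesis by (simp add: divide_inverse)
  qed
  have \<xi>: "\<xi> n powi (-2) = sob_inner \<mu> chi (s n) (s n)" using assms(9) norm_s by simp
  have "sob_inner \<mu> chi (T (p n)) (s n) = sob_inner \<mu> chi (f (n + 1)) (s n)"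
    by (rule sob_inner_cong[OF monic_pol[OF monic_T[OF pm]] monic_pol[OF sm]]) (simp_all add: f)
  then have "a n = sob_inner \<mu> chi (s n) (T (p n)) / sob_inner \<mu> chi (s n) (s n)"
    using assms(11)[of n] norm_s[of n] sob_inner_commute[of chi "T (p n)" "s n"] by simp
  \<comment> \<open>The factor \<open>\<xi> n powi (-2)\<close> is the squared Sobolev norm, the
    denominator of \<open>a n\<close>. Their product is the bare inner product in
    \<open>sobolev_recurrence\<close>.\<close>
  then have a: "a n * sob_inner \<mu> chi (s n) (s n) = sob_inner \<mu> chi (s n) (T (p n))"
    using sob_inner_monic_pos[OF sm[of n], of chi] assms(5) by simp
  have fp: "l2_inner \<mu> (f (n + 1)) (p m) = l2_inner \<mu> (T (p n)) (p m)" for m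
    using f by (intro l2_inner_cong) simp_all
  have b: "b n = l2_inner \<mu> (T (p n)) (p n) / l2_inner \<mu> (p n) (p n)"
    using assms(12)[of n] fp norm_p by simp
  have c: "c n = l2_inner \<mu> (T (p n)) (p (n - 1)) / l2_inner \<mu> (p (n - 1)) (p (n - 1))" if "n \<noteq> 0"
    using assms(13)[of n] fp norm_p that by simp
  have first: "s n x + chi * (L ^^ 2) (s n) x = L (p (n + 1)) x
      + a n * (d n)^2 * \<xi> n powi (-2) * L (p n) x
      + (if n = 0 then 0 else (d (n - 1))^2 * \<xi> n powi (-2) * L (p (n - 1)) x)"
    using sobolev_recurrence[OF p s x, of n] unfolding d \<xi> a[symmetric]
    by (simp add: numeral_2_eq_2)
  \<comment> \<open>Solving this identity for \<open>L (p (n + 1)) x\<close> and substituting it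
    into the first formula yields the second.\<close>
  moreover have "p n x = L (p (n + 1)) x + b n * L (p n) x
      + (if n = 0 then 0 else c n * L (p (n - 1)) x)"
    using legendre_recurrence[OF p x, of n] b c by simp
  ultimately show "s n x + chi * (L ^^ 2) (s n) x = L (p (n + 1)) x
      + a n * (d n)^2 * \<xi> n powi (-2) * L (p n) x
      + (if n = 0 then 0 else (d (n - 1))^2 * \<xi> n powi (-2) * L (p (n - 1)) x)
    \<and> s n x + chi * (L ^^ 2) (s n) x = p n x
      + (a n * (d n)^2 * \<xi> n powi (-2) - b n) * L (p n) x
      + (if n = 0 then 0 else ((d (n - 1))^2 * \<xi> n powi (-2) - c n) * L (p (n - 1)) x)"
    by (simp add: algebra_simps)
qed

end
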